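(* Let $\mathbf{G}$ be a Kac-Moody group, let $\pi^\mu w \in W_{\mathcal{T}}$ and $\beta[n]\in\tilde\Delta^+$. Suppose $\pi^\mu w s_{\beta[n]} > \pi^\mu w$ in the Bruhat order. Then $$\ell(\pi^\mu w s_{\beta[n]}) = \ell(\pi^\mu w) + \#\{ \gamma[m] \in \mathrm{Inv}(s_{\beta[n]}) : \pi^\mu w(\gamma[m]) > 0 \text{ and } \pi^\mu w(-s_{\beta[n]}(\gamma[m])) > 0 \}.$$ In particular, the set $\{ \gamma[m] \in \mathrm{Inv}(s_{\beta[n]}) : \pi^\mu w(\gamma[m]) > 0 \text{ and } \pi^\mu w(-s_{\beta[n]}(\gamma[m])) > 0 \}$ is finite.
   Context: Setup. $\mathbf{G}$ is a Kac-Moody group with finitely many simple roots $\alpha_i$ and simple coroots $\alpha_i^\vee$, $W$ is its Weyl group, $\Delta$ its set of real roots, $\Delta^+\subset\Delta$ the positive real roots. $P$ is the coweight lattice of $\mathbf{G}$ (it contains the coroots and carries an action of $W$), and $\langle\cdot,\cdot\rangle$ is the canonical $W$-invariant pairing between $P$ and the root lattice. For $\beta\in\Delta$, $\beta^\vee$ is the associated coroot and $s_\beta\in W$ the reflection. A coweight $\mu\in P$ is dominant if $\langle\mu,\alpha_i\rangle\ge 0$ for all $i$. The Tits cone $\mathcal{T}\subset P$ is the set of $\mu\in P$ such that $w(\mu)$ is dominant for some $w\in W$; $\mu_+$ denotes the unique dominant element of the $W$-orbit of $\mu\in\mathcal{T}$. $W_P=P\rtimes W$ has elements written $\pi^\mu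 w$ ($\mu\in P$, $w\in W$), and $W_{\mathcal{T}}=\mathcal{T}\rtimes W=\{\pi^\mu w : \mu\in\mathcal{T}, w\in W\}$ is a subsemigroup of $W_P$. $\mathbf{G}$-affine roots: $\tilde\Delta=\{\beta+n\pi : \beta\in\Delta, n\in\mathbb{Z}\}\subset \mathbb{Z}\Delta\oplus\mathbb{Z}\pi$, where $\pi$ is a formal symbol. $\beta+n\pi$ is positive ($>0$) if ($\beta\in\Delta^+$ and $n\ge 0$) or ($\beta\in-\Delta^+$ and $n>0$); otherwise it is negative ($<0$). $\tilde\Delta^+$ is the set of positive elements. For $\beta\in\Delta^+$, $n\in\mathbb{Z}$, set $\beta[n]=\mathrm{sgn}(n)(\beta+n\pi)$, where $\mathrm{sgn}(n)=+1$ if $n\ge0$ and $-1$ if $n<0$; every element of $\tilde\Delta^+$ is uniquely of the form $\beta[n]$. $W_P$ acts on $\tilde\Delta$ by $\pi^\mu w(\beta+n\pi)=w(\beta)+(n+\langle\mu,w(\beta)\rangle)\pi$. The reflection of $\beta[n]$ is $s_{\beta[n]}=\pi^{n\beta^\vee}s_\beta\in W_P$. For $x\in W_P$, $\mathrm{Inv}(x)$ is the set of elements of $\tilde\Delta^+$ made negative by $x$; for $x=w\in W$ this is identified with $\{\gamma\in\Delta^+ : w(\gamma)\in-\Delta^+\}$ when $\gamma\in\Delta^+$ is identified with $\gamma[0]$. Bruhat order: for $x\in W_{\mathcal{T}}$ and $\beta[n]\in\tilde\Delta^+$ with $xs_{\beta[n]}\in W_{\mathcal{T}}$ and $x(\beta[n])>0$,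 declare $xs_{\beta[n]}>x$; the Bruhat order $\leq$ on $W_{\mathcal{T}}$ is the reflexive and transitive closure of these relations (it is known to be a partial order). Length function: fix $\rho$, a sum of fundamental weights, so $\langle\alpha_i^\vee,\rho\rangle=1$ for all $i$. For $\mu\in P$ put $2\cdot\mathrm{ht}(\mu)=\lfloor\langle\mu,2\rho\rangle\rfloor$. For $\pi^\mu w\in W_{\mathcal{T}}$, $$\ell(\pi^\mu w)=2\cdot\mathrm{ht}(\mu_+)+\#\{\gamma\in\mathrm{Inv}(w^{-1}) : \langle\mu,\gamma\rangle\ge0\}-\#\{\gamma\in\mathrm{Inv}(w^{-1}) : \langle\mu,\gamma\rangle<0\},$$ where $\mathrm{Inv}(w^{-1})$ is regarded as a subset of $\Delta^+$. *)

theory Defs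
  imports "HOL-Analysis.Analysis"
begin

text \<open>
  The group itself enters only through its root datum: a lattice \<open>P\<close> (free of finite rank, identified
  with \<open>int ^ 'n\<close> by a choice of basis), simple coroots in \<open>P\<close>, and simple roots acting on \<open>P\<close> as
  integral functionals (given by their coordinates in the dual basis).
  The finite type \<open>'i\<close> indexes the simple roots. The root lattice is the free abelian group
  \<open>int ^ 'i\<close> on the simple roots, so no linear independence of the functionals on \<open>P\<close> is needed.
  An empty index set or a lattice of rank 0 is not covered by finite types, but then there are no roots.
\<close>

record ('n, 'i) root_datum =
  simple_coroot :: "'i::finite \<Rightarrow> int ^ ('n::finite)"
  simple_root :: "'i \<Rightarrow> int ^ 'n"

text \<open>The pairing between \<open>P\<close> and the root lattice; \<open>\<beta>\<close> stands for the sum of the \<open>\<beta> $ i\<close> times the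
  \<open>i\<close>-th simple root.\<close>

definition pairing :: "('n::finite, 'i::finite) root_datum \<Rightarrow> int ^ 'n \<Rightarrow> int ^ 'i \<Rightarrow> int" where
  "pairing D \<mu> \<beta> = (\<Sum>i\<in>UNIV. \<beta> $ i * (\<Sum>k\<in>UNIV. \<mu> $ k * simple_root D i $ k))"

definition alpha :: "'i::finite \<Rightarrow> int ^ 'i" where
  "alpha i = axis i 1"

definition cartan :: "('n::finite, 'i::finite) root_datum \<Rightarrow> 'i \<Rightarrow> 'i \<Rightarrow> int" where
  "cartan D i j = pairing D (simple_coroot D i) (alpha j)"

definition kac_moody_datum :: "('n::finite, 'i::finite) root_datum \<Rightarrow> bool" where
  "kac_moody_datum D \<longleftrightarrow>
     (\<forall>i. cartan D i i = 2) \<and>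
     (\<forall>i j. i \<noteq> j \<longrightarrow> cartan D i j \<le> 0) \<and>
     (\<forall>i j. cartan D i j = 0 \<longleftrightarrow> cartan D j i = 0)"


text \<open>
  An element of the Weyl group is represented by the pair of its actions on \<open>P\<close> and on the root
  lattice. As the action on the root lattice is faithful, the group of pairs generated by the
  simple reflections is the Weyl group (the action on \<open>P\<close> alone need not be faithful).
\<close>

type_synonym ('n, 'i) weyl = "(int ^ 'n \<Rightarrow> int ^ 'n) \<times> (int ^ 'i \<Rightarrow> int ^ 'i)"

definition weyl_one :: "('n::finite, 'i::finite) weyl" where
  "weyl_one = (id, id)"

definition weyl_mult :: "('n::finite, 'i::finite) weyl \<Rightarrow> ('n, 'i) weyl \<Rightarrow> ('n, 'i) weyl" where
  "weyl_mult v w = (fst v \<circ> fst w, snd v \<circ> snd w)"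

definition weyl_inverse :: "('n::finite, 'i::finite) weyl \<Rightarrow> ('n, 'i) weyl" where
  "weyl_inverse w = (inv (fst w), inv (snd w))"

definition simple_reflection :: "('n::finite, 'i::finite) root_datum \<Rightarrow> 'i \<Rightarrow> ('n, 'i) weyl" where
  "simple_reflection D i =
     ((\<lambda>\<mu>. \<mu> - pairing D \<mu> (alpha i) *s simple_coroot D i),
      (\<lambda>\<gamma>. \<gamma> - pairing D (simple_coroot D i) \<gamma> *s alpha i))"

inductive_set weyl_group :: "('n::finite, 'i::finite) root_datum \<Rightarrow> ('n, 'i) weyl set"
  for D :: "('n, 'i) root_datum" where
  one: "weyl_one \<in> weyl_group D"
| step: "w \<in> weyl_group D \<Longrightarrow> weyl_mult (simple_reflection D i) w \<in> weyl_group D"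

definition real_roots :: "('n::finite, 'i::finite) root_datum \<Rightarrow> (int ^ 'i) set" where
  "real_roots D = {snd w (alpha i) | w i. w \<in> weyl_group D}"

definition pos_roots :: "('n::finite, 'i::finite) root_datum \<Rightarrow> (int ^ 'i) set" where
  "pos_roots D = {\<beta> \<in> real_roots D. \<forall>i. 0 \<le> \<beta> $ i}"

definition coroot :: "('n::finite, 'i::finite) root_datum \<Rightarrow> int ^ 'i \<Rightarrow> int ^ 'n" where
  "coroot D \<beta> = (THE h. \<exists>w\<in>weyl_group D. \<exists>i. \<beta> = snd w (alpha i) \<and> h = fst w (simple_coroot D i))"

definition reflection :: "('n::finite, 'i::finite) root_datum \<Rightarrow> int ^ 'i \<Rightarrow> ('n, 'i) weyl" where
  "reflection D \<beta> =
     ((\<lambda>\<mu>. \<mu> - pairing D \<mu> \<beta> *s coroot D \<beta>),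
      (\<lambda>\<gamma>. \<gamma> - pairing D (coroot D \<beta>) \<gamma> *s \<beta>))"

definition dominant :: "('n::finite, 'i::finite) root_datum \<Rightarrow> int ^ 'n \<Rightarrow> bool" where
  "dominant D \<mu> \<longleftrightarrow> (\<forall>i. 0 \<le> pairing D \<mu> (alpha i))"

definition tits_cone :: "('n::finite, 'i::finite) root_datum \<Rightarrow> (int ^ 'n) set" where
  "tits_cone D = {\<mu>. \<exists>w\<in>weyl_group D. dominant D (fst w \<mu>)}"

definition dominant_rep :: "('n::finite, 'i::finite) root_datum \<Rightarrow> int ^ 'n \<Rightarrow> int ^ 'n" where
  "dominant_rep D \<mu> = (THE \<nu>. dominant D \<nu> \<and> (\<exists>w\<in>weyl_group D. \<nu> = fst w \<mu>))"


text \<open>The pair \<open>(\<mu>, w)\<close> is the element \<open>\<pi>\<^sup>\<mu> w\<close> of the semidirect product of \<open>P\<close> and the Weyl group.\<close>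

type_synonym ('n, 'i) affine_weyl = "(int ^ 'n) \<times> ('n, 'i) weyl"

definition aff_mult ::
  "('n::finite, 'i::finite) affine_weyl \<Rightarrow> ('n, 'i) affine_weyl \<Rightarrow> ('n, 'i) affine_weyl" where
  "aff_mult x y = (fst x + fst (snd x) (fst y), weyl_mult (snd x) (snd y))"

definition W_tits :: "('n::finite, 'i::finite) root_datum \<Rightarrow> ('n, 'i) affine_weyl set" where
  "W_tits D = tits_cone D \<times> weyl_group D"

text \<open>The pair \<open>(\<beta>, n)\<close> is the affine root \<open>\<beta> + n\<pi>\<close>.\<close>

type_synonym 'i affine_root = "(int ^ 'i) \<times> int"

definition affine_roots :: "('n::finite, 'i::finite) root_datum \<Rightarrow> 'i affine_root set" where
  "affine_roots D = real_roots D \<times> UNIV"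

definition aff_pos :: "('n::finite, 'i::finite) root_datum \<Rightarrow> 'i affine_root \<Rightarrow> bool" where
  "aff_pos D a \<longleftrightarrow>
     (fst a \<in> pos_roots D \<and> 0 \<le> snd a) \<or> (- fst a \<in> pos_roots D \<and> 0 < snd a)"

definition pos_affine_roots :: "('n::finite, 'i::finite) root_datum \<Rightarrow> 'i affine_root set" where
  "pos_affine_roots D = {a \<in> affine_roots D. aff_pos D a}"

definition aff_neg :: "('n::finite, 'i::finite) root_datum \<Rightarrow> 'i affine_root \<Rightarrow> bool" where
  "aff_neg D a \<longleftrightarrow> a \<in> affine_roots D \<and> \<not> aff_pos D a"

definition bracket :: "int ^ ('i::finite) \<Rightarrow> int \<Rightarrow> 'i affine_root" where
  "bracket \<beta> n = (if 0 \<le> n then (\<beta>, n) else (- \<beta>, - n))"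

definition aff_act ::
  "('n::finite, 'i::finite) root_datum \<Rightarrow> ('n, 'i) affine_weyl \<Rightarrow> 'i affine_root \<Rightarrow> 'i affine_root" where
  "aff_act D x a = (let \<gamma> = snd (snd x) (fst a) in (\<gamma>, snd a + pairing D (fst x) \<gamma>))"

text \<open>The reflection of \<open>bracket \<beta> n\<close>, for a positive real root \<open>\<beta>\<close>.\<close>

definition aff_reflection ::
  "('n::finite, 'i::finite) root_datum \<Rightarrow> int ^ 'i \<Rightarrow> int \<Rightarrow> ('n, 'i) affine_weyl" where
  "aff_reflection D \<beta> n = (n *s coroot D \<beta>, reflection D \<beta>)"

definition aff_inversions ::
  "('n::finite, 'i::finite) root_datum \<Rightarrow> ('n, 'i) affine_weyl \<Rightarrow> 'i affine_root set" where
  "aff_inversions D x = {a \<in> pos_affine_roots D. aff_neg D (aff_act D x a)}"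

definition weyl_inversions ::
  "('n::finite, 'i::finite) root_datum \<Rightarrow> ('n, 'i) weyl \<Rightarrow> (int ^ 'i) set" where
  "weyl_inversions D w = {\<gamma> \<in> pos_roots D. - snd w \<gamma> \<in> pos_roots D}"


definition bruhat_step ::
  "('n::finite, 'i::finite) root_datum \<Rightarrow> ('n, 'i) affine_weyl \<Rightarrow> ('n, 'i) affine_weyl \<Rightarrow> bool" where
  "bruhat_step D x y \<longleftrightarrow>
     x \<in> W_tits D \<and> y \<in> W_tits D \<and>
     (\<exists>\<beta>\<in>pos_roots D. \<exists>n. y = aff_mult x (aff_reflection D \<beta> n) \<and>
        aff_pos D (aff_act D x (bracket \<beta> n)))"

definition bruhat_le ::
  "('n::finite, 'i::finite) root_datum \<Rightarrow> ('n, 'i) affine_weyl \<Rightarrow> ('n, 'i) affine_weyl \<Rightarrow> bool" where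
  "bruhat_le D x y \<longleftrightarrow> x \<in> W_tits D \<and> (bruhat_step D)\<^sup>*\<^sup>* x y"

definition bruhat_less ::
  "('n::finite, 'i::finite) root_datum \<Rightarrow> ('n, 'i) affine_weyl \<Rightarrow> ('n, 'i) affine_weyl \<Rightarrow> bool" where
  "bruhat_less D x y \<longleftrightarrow> bruhat_le D x y \<and> x \<noteq> y"


text \<open>Fundamental weights are only required to be real functionals on \<open>P\<close>, which is why the height
  below involves a floor.\<close>

definition weight_pairing :: "int ^ ('n::finite) \<Rightarrow> real ^ 'n \<Rightarrow> real" where
  "weight_pairing \<mu> \<phi> = (\<Sum>k\<in>UNIV. real_of_int (\<mu> $ k) * \<phi> $ k)"

definition fundamental_weights ::
  "('n::finite, 'i::finite) root_datum \<Rightarrow> ('i \<Rightarrow> real ^ 'n) \<Rightarrow> bool" where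
  "fundamental_weights D \<Lambda> \<longleftrightarrow>
     (\<forall>i j. weight_pairing (simple_coroot D j) (\<Lambda> i) = (if i = j then 1 else 0))"

definition is_rho :: "('n::finite, 'i::finite) root_datum \<Rightarrow> real ^ 'n \<Rightarrow> bool" where
  "is_rho D \<rho> \<longleftrightarrow> (\<exists>\<Lambda>. fundamental_weights D \<Lambda> \<and> \<rho> = (\<Sum>i\<in>UNIV. \<Lambda> i))"

definition two_ht :: "real ^ ('n::finite) \<Rightarrow> int ^ 'n \<Rightarrow> int" where
  "two_ht \<rho> \<mu> = \<lfloor>weight_pairing \<mu> (2 *\<^sub>R \<rho>)\<rfloor>"

definition aff_length ::
  "('n::finite, 'i::finite) root_datum \<Rightarrow> real ^ 'n \<Rightarrow> ('n, 'i) affine_weyl \<Rightarrow> int" where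
  "aff_length D \<rho> x = (let \<mu> = fst x; w = snd x in
     two_ht \<rho> (dominant_rep D \<mu>)
     + int (card {\<gamma> \<in> weyl_inversions D (weyl_inverse w). 0 \<le> pairing D \<mu> \<gamma>})
     - int (card {\<gamma> \<in> weyl_inversions D (weyl_inverse w). pairing D \<mu> \<gamma> < 0}))"

end

theory Submission
  imports Defs
begin

text \<open>
  For \<open>x = \<pi>\<^sup>\<mu> w\<close> and a positive real root \<open>\<alpha>\<close>, the number of inversions of the inverse of \<open>x\<close> whose
  vector part is \<open>\<plusminus> \<alpha>\<close> is \<open>|\<langle>\<mu>, \<alpha>\<rangle>|\<close>, plus or minus 1 if \<open>\<alpha>\<close> is an inversion of the inverse of \<open>w\<close>.
  Since \<open>2 ht (\<mu>\<^sub>+) = 2 ht \<mu> + \<Sum>\<^sub>\<alpha> (|\<langle>\<mu>, \<alpha>\<rangle>| - \<langle>\<mu>, \<alpha>\<rangle>)\<close> with only finitely many nonzero terms, the length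
  of \<open>x\<close> is the sum over \<open>\<alpha>\<close> of these numbers, regularized by subtracting \<open>\<langle>\<mu>, \<alpha>\<rangle>\<close> from each, plus
  \<open>2 ht \<mu>\<close>. Passing from \<open>x\<close> to \<open>x s\<close> adds a multiple of a coroot \<open>\<theta>\<^sup>\<or>\<close> to \<open>\<mu>\<close>. On a finite set of roots
  that contains the inversions of \<open>s\<^sub>\<theta>\<close> and is stable under \<open>s\<^sub>\<theta>\<close> and negation, the positive roots
  pair with \<open>\<theta>\<^sup>\<or>\<close> to \<open>2 ht (\<theta>\<^sup>\<or>)\<close> in total, so the regularizing terms cancel and the difference of
  lengths is a difference of two finite numbers of inversions, counted as in a finite Coxeter group.
  The result does not depend on the finite set, which also gives the finiteness claim. In particular
  Bruhat steps increase the length, so \<open>x < x s\<close> forces \<open>x (\<beta>[n]) > 0\<close>.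
\<close>

section \<open>Bilinearity of the pairing and composition of Weyl pairs\<close>

lemma pairing_add_left: "pairing D (x + y) b = pairing D x b + pairing D y b"
  by (simp add: pairing_def algebra_simps sum.distrib)

lemma pairing_add_right: "pairing D x (b + c) = pairing D x b + pairing D x c"
  by (simp add: pairing_def algebra_simps sum.distrib)

lemma pairing_smult_left: "pairing D (c *s x) b = c * pairing D x b"
  by (simp add: pairing_def algebra_simps sum_distrib_left)

lemma pairing_smult_right: "pairing D x (c *s b) = c * pairing D x b"
  by (simp add: pairing_def algebra_simps sum_distrib_left)

lemma pairing_diff_left: "pairing D (x - y) b = pairing D x b - pairing D y b"
  by (simp add: pairing_def algebra_simps sum_subtractf)

lemma pairing_diff_right: "pairing D x (b - c) = pairing D x b - pairing D x c"
  by (simp add: pairing_def algebra_simps sum_subtractf)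

lemma pairing_uminus_left: "pairing D (- x) b = - pairing D x b"
  by (simp add: pairing_def sum_negf)

lemma pairing_uminus_right: "pairing D x (- b) = - pairing D x b"
  by (simp add: pairing_def sum_negf)

lemmas pairing_simps =
  pairing_add_left pairing_add_right pairing_smult_left pairing_smult_right
  pairing_diff_left pairing_diff_right pairing_uminus_left pairing_uminus_right

lemma pairing_eq_sum_alpha: "pairing D \<mu> \<gamma> = (\<Sum>i\<in>UNIV. \<gamma> $ i * pairing D \<mu> (alpha i))"
proof -
  have "pairing D \<mu> (alpha i) = (\<Sum>k\<in>UNIV. \<mu> $ k * simple_root D i $ k)" for i
    by (simp add: pairing_def alpha_def axis_def if_distrib[of "\<lambda>x. x * _"] cong: if_cong)
  then show ?thesis
    by (simp add: pairing_def)
qed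

lemma weyl_mult_assoc: "weyl_mult (weyl_mult u v) w = weyl_mult u (weyl_mult v w)"
  by (simp add: weyl_mult_def comp_assoc)

lemma weyl_mult_one [simp]: "weyl_mult weyl_one w = w" "weyl_mult w weyl_one = w"
  by (simp_all add: weyl_mult_def weyl_one_def)

lemma fst_weyl_mult [simp]: "fst (weyl_mult u v) x = fst u (fst v x)"
  by (simp add: weyl_mult_def)

lemma snd_weyl_mult [simp]: "snd (weyl_mult u v) x = snd u (snd v x)"
  by (simp add: weyl_mult_def)

lemma weyl_one_apply [simp]: "fst weyl_one x = x" "snd weyl_one y = y"
  by (simp_all add: weyl_one_def)

lemma weyl_eqI:
  assumes "\<And>x. fst u x = fst v x" "\<And>y. snd u y = snd v y"
  shows "u = v"
  using assms by (simp add: prod_eq_iff fun_eq_iff)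

section \<open>The Weyl group and its two linear actions\<close>

locale kac_moody =
  fixes D :: "('n::finite, 'i::finite) root_datum"
  assumes datum: "kac_moody_datum D"
begin

abbreviation pair :: "int ^ 'n \<Rightarrow> int ^ 'i \<Rightarrow> int" (\<open>\<langle>_, _\<rangle>\<close>) where
  "\<langle>\<mu>, \<gamma>\<rangle> \<equiv> pairing D \<mu> \<gamma>"

abbreviation mult :: "('n, 'i) weyl \<Rightarrow> ('n, 'i) weyl \<Rightarrow> ('n, 'i) weyl" (infixl \<open>\<cdot>\<close> 70) where
  "u \<cdot> v \<equiv> weyl_mult u v"

abbreviation "W \<equiv> weyl_group D"
abbreviation "S \<equiv> simple_reflection D"
abbreviation "H \<equiv> simple_coroot D"

lemma pair_diag [simp]: "\<langle>H i, alpha i\<rangle> = 2"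
  using datum by (simp add: kac_moody_datum_def cartan_def)

lemma fst_S: "fst (S i) \<mu> = \<mu> - \<langle>\<mu>, alpha i\<rangle> *s H i"
  by (simp add: simple_reflection_def)

lemma snd_S: "snd (S i) \<gamma> = \<gamma> - \<langle>H i, \<gamma>\<rangle> *s alpha i"
  by (simp add: simple_reflection_def)

lemma S_square [simp]: "S i \<cdot> S i = weyl_one"
  by (rule weyl_eqI) (simp_all add: fst_S snd_S pairing_simps vec_eq_iff algebra_simps)

lemma S_cancel_left [simp]: "S i \<cdot> (S i \<cdot> w) = w"
  by (simp flip: weyl_mult_assoc)

lemma S_cancel_right [simp]: "w \<cdot> S i \<cdot> S i = w"
  by (simp add: weyl_mult_assoc)

lemma W_mult:
  assumes "u \<in> W" "v \<in> W" shows "u \<cdot> v \<in> W"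
  using assms(1) by induction (use assms(2) in \<open>auto simp: weyl_mult_assoc intro: weyl_group.step\<close>)

lemma S_in_W [simp]: "S i \<in> W"
  using weyl_group.step[OF weyl_group.one, of D i] by simp

text \<open>Simple reflections are involutions, so an inverse \<open>v\<close> of \<open>w\<close>
  gives the inverse \<open>v \<cdot> S i\<close> of \<open>S i \<cdot> w\<close>.\<close>

lemma W_inverse_ex:
  assumes "w \<in> W" shows "\<exists>v\<in>W. v \<cdot> w = weyl_one \<and> w \<cdot> v = weyl_one"
  using assms
proof induction
  case one
  then show ?case using weyl_group.one by force
next
  case (step w i)
  then obtain v where "v \<in> W" "v \<cdot> w = weyl_one" "w \<cdot> v = weyl_one" by blast
  then have "v \<cdot> S i \<cdot> (S i \<cdot> w) = weyl_one" "S i \<cdot> w \<cdot> (v \<cdot> S i) = weyl_one"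
    by (simp_all add: weyl_mult_assoc) (simp flip: weyl_mult_assoc[of w])
  with \<open>v \<in> W\<close> show ?case by (meson S_in_W W_mult)
qed

text \<open>\<open>weyl_inverse\<close> applies \<open>inv\<close> to both components, which is a
  genuine inverse only for bijections. A two-sided inverse inside the group settles bijectivity and
  identifies the value.\<close>

lemma W_inverse:
  assumes "w \<in> W"
  shows "weyl_inverse w \<in> W" "weyl_inverse w \<cdot> w = weyl_one" "w \<cdot> weyl_inverse w = weyl_one"
proof -
  obtain v where v: "v \<in> W" "v \<cdot> w = weyl_one" "w \<cdot> v = weyl_one"
    using W_inverse_ex[OF assms] by blast
  have "fst v (fst w x) = x" "fst w (fst v x) = x" for x
    using v(2,3) by (metis fst_weyl_mult weyl_one_apply(1))+
  moreover have "snd v (snd w x) = x" "snd w (snd v x) = x" for x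
    using v(2,3) by (metis snd_weyl_mult weyl_one_apply(2))+
  ultimately have "inv (fst w) = fst v" "inv (snd w) = snd v"
    by (auto intro!: inv_equality)
  then have "weyl_inverse w = v"
    by (simp add: weyl_inverse_def)
  with v show "weyl_inverse w \<in> W" "weyl_inverse w \<cdot> w = weyl_one" "w \<cdot> weyl_inverse w = weyl_one"
    by simp_all
qed

lemma W_inverse_apply [simp]:
  assumes "w \<in> W"
  shows "fst (weyl_inverse w) (fst w x) = x" "fst w (fst (weyl_inverse w) x) = x"
    "snd (weyl_inverse w) (snd w y) = y" "snd w (snd (weyl_inverse w) y) = y"
  using W_inverse(2,3)[OF assms] by (metis fst_weyl_mult snd_weyl_mult weyl_one_apply)+

text \<open>For a simple reflection the correction terms cancel because \<open>H i\<close> pairs to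
  2 with \<open>alpha i\<close>.\<close>

lemma W_pairing:
  assumes "w \<in> W" shows "\<langle>fst w \<mu>, snd w \<gamma>\<rangle> = \<langle>\<mu>, \<gamma>\<rangle>"
  using assms by induction (simp_all add: fst_S snd_S pairing_simps)

lemma W_pairing_left:
  assumes "w \<in> W" shows "\<langle>fst w \<mu>, \<gamma>\<rangle> = \<langle>\<mu>, snd (weyl_inverse w) \<gamma>\<rangle>"
  using W_pairing[OF assms, of \<mu> "snd (weyl_inverse w) \<gamma>"] assms by simp

lemma W_pairing_right:
  assumes "w \<in> W" shows "\<langle>\<mu>, snd w \<gamma>\<rangle> = \<langle>fst (weyl_inverse w) \<mu>, \<gamma>\<rangle>"
  using W_pairing[OF assms, of "fst (weyl_inverse w) \<mu>" \<gamma>] assms by simp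

lemma S_linear:
  "fst (S i) (x + y) = fst (S i) x + fst (S i) y" "snd (S i) (u + v) = snd (S i) u + snd (S i) v"
  "fst (S i) (c *s x) = c *s fst (S i) x" "snd (S i) (c *s u) = c *s snd (S i) u"
  by (simp_all add: fst_S snd_S pairing_simps vec_eq_iff algebra_simps)

lemma W_fst_add: "w \<in> W \<Longrightarrow> fst w (x + y) = fst w x + fst w y"
  by (induction rule: weyl_group.induct) (simp_all add: S_linear)

lemma W_snd_add: "w \<in> W \<Longrightarrow> snd w (x + y) = snd w x + snd w y"
  by (induction rule: weyl_group.induct) (simp_all add: S_linear)

lemma W_fst_smult: "w \<in> W \<Longrightarrow> fst w (c *s x) = c *s fst w x"
  by (induction rule: weyl_group.induct) (simp_all add: S_linear)

lemma W_snd_smult: "w \<in> W \<Longrightarrow> snd w (c *s x) = c *s snd w x"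
  by (induction rule: weyl_group.induct) (simp_all add: S_linear)

lemma W_fst_diff: "w \<in> W \<Longrightarrow> fst w (x - y) = fst w x - fst w y"
  using W_fst_add[of w "x - y" y] by simp

lemma W_snd_diff: "w \<in> W \<Longrightarrow> snd w (x - y) = snd w x - snd w y"
  using W_snd_add[of w "x - y" y] by simp

lemma W_snd_zero: "w \<in> W \<Longrightarrow> snd w 0 = 0"
  using W_snd_diff[of w 0 0] by simp

lemma W_snd_uminus: "w \<in> W \<Longrightarrow> snd w (- x) = - snd w x"
  using W_snd_diff[of w 0 x] by (simp add: W_snd_zero)

lemma W_snd_inj: "w \<in> W \<Longrightarrow> snd w x = snd w y \<longleftrightarrow> x = y"
  by (metis W_inverse_apply(3))

section \<open>Positivity of roots\<close>

primrec word :: "'i list \<Rightarrow> ('n, 'i) weyl" where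
  "word [] = weyl_one"
| "word (i # is) = S i \<cdot> word is"

definition len :: "('n, 'i) weyl \<Rightarrow> nat" where
  "len w = (LEAST k. \<exists>is. length is = k \<and> word is = w)"

lemma word_append: "word (is @ js) = word is \<cdot> word js"
  by (induction "is") (simp_all add: weyl_mult_assoc)

lemma word_in_W [simp]: "word is \<in> W"
  by (induction "is") (auto intro: weyl_group.intros)

lemma W_word: "w \<in> W \<Longrightarrow> \<exists>is. word is = w"
proof (induction rule: weyl_group.induct)
  case one
  show ?case by (rule exI[of _ "[]"]) simp
next
  case (step w i)
  then show ?case by (metis word.simps(2))
qed

lemma reduced_word:
  assumes "w \<in> W" obtains "is" where "length is = len w" "word is = w"
  using LeastI_ex[of "\<lambda>k. \<exists>is. length is = k \<and> word is = w"] W_word[OF assms]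
  unfolding len_def by blast

lemma len_word_le: "len (word is) \<le> length is"
  unfolding len_def by (rule Least_le) blast

lemma len_mult_word_le:
  assumes "w \<in> W" shows "len (w \<cdot> word js) \<le> len w + length js"
proof -
  obtain "is" where "length is = len w" "word is = w" using reduced_word[OF assms] .
  then show ?thesis using len_word_le[of "is @ js"] by (simp add: word_append)
qed

lemma len_mult_S_le: "w \<in> W \<Longrightarrow> len (w \<cdot> S i) \<le> Suc (len w)"
  using len_mult_word_le[of w "[i]"] by simp

text \<open>Deleting the last letter of a reduced word shortens \<open>w\<close>; multiplying it
  back shows that the drop is exactly one.\<close>

lemma len_descent:
  assumes "w \<in> W" "w \<noteq> weyl_one" obtains i where "Suc (len (w \<cdot> S i)) = len w"
proof -
  obtain "is" where isw: "length is = len w" "word is = w" using reduced_word[OF assms(1)] .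
  then have "is \<noteq> []" using assms(2) by auto
  then obtain js i where js: "is = js @ [i]" by (metis rev_exhaust)
  then have w: "word js = w \<cdot> S i" using isw(2) by (auto simp: word_append weyl_mult_assoc)
  have "len (w \<cdot> S i) \<le> length js" using len_word_le[of js] w by simp
  moreover have "len w \<le> Suc (len (w \<cdot> S i))"
    using len_mult_S_le[of "w \<cdot> S i" i] w word_in_W[of js] by simp
  ultimately have "Suc (len (w \<cdot> S i)) = len w" using isw(1) js by simp
  then show thesis by (rule that)
qed

section \<open>Alternating products of two simple reflections\<close>

fun alt :: "'i \<Rightarrow> 'i \<Rightarrow> nat \<Rightarrow> ('n, 'i) weyl" where
  "alt s t 0 = weyl_one"
| "alt s t (Suc k) = alt t s k \<cdot> S t"

text \<open>The recursion fixes \<open>S t\<close> as the rightmost factor. Growing the product on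
  the left instead is what the study of alternating suffixes requires, and there the new letter
  depends on parity.\<close>

lemma alt_Suc_front: "alt s t (Suc k) = S (if even k then t else s) \<cdot> alt s t k"
proof (induction k arbitrary: s t)
  case (Suc k)
  have "alt s t (Suc (Suc k)) = S (if even k then s else t) \<cdot> (alt t s k \<cdot> S t)"
    unfolding alt.simps(2)[of s t "Suc k"] Suc by (simp add: weyl_mult_assoc)
  then show ?case by simp
qed simp

lemma alt_word: "\<exists>is. length is = k \<and> alt s t k = word is"
proof (induction k)
  case (Suc k)
  then obtain "is" where "length is = k" "alt s t k = word is" by blast
  then show ?case unfolding alt_Suc_front
    by (intro exI[of _ "(if even k then t else s) # is"]) simp
qed simp

lemma alt_split: "\<exists>is. length is = j \<and> alt s t (j + m) = word is \<cdot> alt s t m"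
proof (induction j)
  case (Suc j)
  then obtain "is" where "length is = j" "alt s t (j + m) = word is \<cdot> alt s t m" by blast
  then show ?case unfolding add_Suc alt_Suc_front
    by (intro exI[of _ "(if even (j + m) then t else s) # is"]) (simp add: weyl_mult_assoc)
qed simp

text \<open>The braid relation rewrites the last \<open>m\<close> factors so that they end in
  \<open>S s\<close>, which cancels against the appended \<open>S s\<close>.\<close>

lemma alt_shorten:
  assumes "alt s t m = alt t s m" "0 < m" "m \<le> k"
  shows "\<exists>is. length is < k \<and> alt s t k \<cdot> S s = word is"
proof -
  obtain m' where m': "m = Suc m'" using assms(2) by (cases m) auto
  obtain "is" where isw: "length is = k - m" "alt s t k = word is \<cdot> alt s t m"
    using alt_split[of "k - m" s t m] assms(3) by auto
  obtain js where js: "length js = m'" "alt s t m' = word js"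
    using alt_word by blast
  have "alt s t k \<cdot> S s = word (is @ js)"
    using isw(2) js(2) unfolding assms(1) unfolding m' by (simp add: word_append weyl_mult_assoc)
  then show ?thesis using isw js m' assms(3) by (intro exI[of _ "is @ js"]) auto
qed

context
  fixes s t :: 'i and a b :: int
  assumes a: "\<langle>H s, alpha t\<rangle> = - a" and b: "\<langle>H t, alpha s\<rangle> = - b"
begin

text \<open>The group generated by \<open>S s\<close> and \<open>S t\<close> moves
  \<open>\<mu>\<close> only along the two coroots, so an alternating product is evaluated by
  tracking two integer coordinates.\<close>

lemma fst_S_span:
  "fst (S s) (\<mu> - x *s H s - y *s H t) = \<mu> - (\<langle>\<mu>, alpha s\<rangle> - x + b * y) *s H s - y *s H t"
  "fst (S t) (\<mu> - x *s H s - y *s H t) = \<mu> - x *s H s - (\<langle>\<mu>, alpha t\<rangle> - y + a * x) *s H t"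
  by (simp_all add: fst_S pairing_simps vec_eq_iff a b algebra_simps)

lemma snd_S_span:
  "snd (S s) (\<gamma> - x *s alpha s - y *s alpha t)
    = \<gamma> - (\<langle>H s, \<gamma>\<rangle> - x + a * y) *s alpha s - y *s alpha t"
  "snd (S t) (\<gamma> - x *s alpha s - y *s alpha t)
    = \<gamma> - x *s alpha s - (\<langle>H t, \<gamma>\<rangle> - y + b * x) *s alpha t"
  by (simp_all add: snd_S pairing_simps vec_eq_iff a b algebra_simps)

text \<open>The triples are the rank two Cartan matrices of types A1 x A1, A2, B2 and G2 with their
  Coxeter exponent \<open>m\<close>. Both sides are computed in the coordinates above, starting at
  the origin, on each lattice separately.\<close>

lemma braid:
  assumes "(a, b, m) \<in> {(0,0,2), (1,1,3), (1,2,4), (2,1,4), (1,3,6), (3,1,6)}"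
  shows "alt s t m = alt t s m"
proof (rule weyl_eqI)
  fix \<mu>
  define G where "G x y = \<mu> - x *s H s - y *s H t" for x y
  have "fst (alt s t m) (G 0 0) = fst (alt t s m) (G 0 0)"
    using assms fst_S_span[of \<mu>, folded G_def] by (auto simp: eval_nat_numeral algebra_simps)
  then show "fst (alt s t m) \<mu> = fst (alt t s m) \<mu>" by (simp add: G_def)
next
  fix \<gamma>
  define G where "G x y = \<gamma> - x *s alpha s - y *s alpha t" for x y
  have "snd (alt s t m) (G 0 0) = snd (alt t s m) (G 0 0)"
    using assms snd_S_span[of \<gamma>, folded G_def] by (auto simp: eval_nat_numeral algebra_simps)
  then show "snd (alt s t m) \<gamma> = snd (alt t s m) \<gamma>" by (simp add: G_def)
qed

lemma S_comb:
  "snd (S s) (x *s alpha s + y *s alpha t) = (a * y - x) *s alpha s + y *s alpha t"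
  "snd (S t) (x *s alpha s + y *s alpha t) = x *s alpha s + (b * x - y) *s alpha t"
  by (simp_all add: snd_S pairing_simps vec_eq_iff a b algebra_simps)

text \<open>For \<open>a * b \<ge> 4\<close> the inequality between \<open>x\<close> and \<open>y\<close> makes the coefficients nondecreasing.\<close>

lemma alt_pos_infinite:
  assumes "0 \<le> a" "0 \<le> b" "4 \<le> a * b"
  shows "\<exists>x y. 0 \<le> x \<and> 0 \<le> y \<and> snd (alt s t k) (alpha s) = x *s alpha s + y *s alpha t
    \<and> (if even k then 2 * y \<le> b * x else 2 * x \<le> a * y)"
proof (induction k)
  case 0
  show ?case using assms by (intro exI[of _ 1] exI[of _ 0]) simp
next
  case (Suc k)
  then obtain x y where xy: "0 \<le> x" "0 \<le> y" "snd (alt s t k) (alpha s) = x *s alpha s + y *s alpha t"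
    "if even k then 2 * y \<le> b * x else 2 * x \<le> a * y" by blast
  show ?case
  proof (cases "even k")
    case True
    have "a * (2 * (b * x - y)) \<ge> a * (b * x)"
      using xy(4) True assms(1) by (intro mult_left_mono) auto
    moreover have "a * b * x \<ge> 4 * x" using assms(3) xy(1) by (rule mult_right_mono)
    ultimately have "2 * x \<le> a * (b * x - y)" by (simp add: algebra_simps)
    then show ?thesis using xy True S_comb
      by (intro exI[of _ x] exI[of _ "b * x - y"]) (simp add: alt_Suc_front del: alt.simps)
  next
    case False
    have "b * (2 * (a * y - x)) \<ge> b * (a * y)"
      using xy(4) False assms(2) by (intro mult_left_mono) auto
    moreover have "a * b * y \<ge> 4 * y" using assms(3) xy(2) by (rule mult_right_mono)
    ultimately have "2 * y \<le> b * (a * y - x)" by (simp add: algebra_simps)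
    then show ?thesis using xy False S_comb
      by (intro exI[of _ "a * y - x"] exI[of _ y]) (simp add: alt_Suc_front del: alt.simps)
  qed
qed

text \<open>Since \<open>m\<close> is at most 6, the first \<open>m\<close> images of
  \<open>alpha s\<close> can be listed for each type.\<close>

lemma alt_pos_finite:
  assumes "(a, b, m) \<in> {(0,0,2), (1,1,3), (1,2,4), (2,1,4), (1,3,6), (3,1,6)}" "k < m"
  shows "\<exists>x y. 0 \<le> x \<and> 0 \<le> y \<and> snd (alt s t k) (alpha s) = x *s alpha s + y *s alpha t"
proof -
  define G where "G x y = x *s alpha s + y *s alpha t" for x y
  define P where "P v \<longleftrightarrow> (\<exists>x y. 0 \<le> x \<and> 0 \<le> y \<and> v = G x y)" for v
  have P: "P (G x y)" if "0 \<le> x" "0 \<le> y" for x y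
    using that by (auto simp: P_def)
  have "k = 0 \<or> k = 1 \<or> k = 2 \<or> k = 3 \<or> k = 4 \<or> k = 5" using assms by auto
  then have "P (snd (alt s t k) (G 1 0))"
    using assms S_comb[folded G_def]
    by (elim disjE) (auto simp: eval_nat_numeral alt_Suc_front simp del: alt.simps(2) intro!: P)
  moreover have "G 1 0 = alpha s" by (simp add: G_def)
  ultimately show ?thesis by (simp add: P_def G_def)
qed

end

text \<open>If both numbers are positive, each is bounded by the product, hence by 3; the zero
  pattern leaves only (0,0) otherwise.\<close>

lemma cartan_small:
  fixes a b :: int
  assumes "0 \<le> a" "0 \<le> b" "a = 0 \<longleftrightarrow> b = 0" "a * b < 4"
  obtains m where "(a, b, m::nat) \<in> {(0,0,2), (1,1,3), (1,2,4), (2,1,4), (1,3,6), (3,1,6)}" "0 < m"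
proof -
  have "a \<le> a * b \<and> b \<le> a * b" if "a \<ge> 1" "b \<ge> 1"
    using that mult_mono[of a a 1 b] mult_mono[of 1 a b b] by auto
  then have "a \<le> 3 \<and> b \<le> 3" using assms by (cases "a \<ge> 1"; cases "b \<ge> 1"; linarith)
  then have "(a = 0 \<or> a = 1 \<or> a = 2 \<or> a = 3) \<and> (b = 0 \<or> b = 1 \<or> b = 2 \<or> b = 3)"
    using assms(1,2) by arith
  then have "(a, b) \<in> {(0,0), (1,1), (1,2), (2,1), (1,3), (3,1)}"
    using assms by auto
  then show thesis using that by force
qed

lemma cartan_offdiag:
  assumes "s \<noteq> t"
  shows "\<langle>H s, alpha t\<rangle> \<le> 0" "\<langle>H s, alpha t\<rangle> = 0 \<longleftrightarrow> \<langle>H t, alpha s\<rangle> = 0"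
  using datum assms by (auto simp: kac_moody_datum_def cartan_def)

definition nonneg :: "int ^ 'i \<Rightarrow> bool" where
  "nonneg \<gamma> \<longleftrightarrow> (\<forall>i. 0 \<le> \<gamma> $ i)"

lemma alpha_nth: "alpha i $ j = (if i = j then 1 else 0)"
  by (simp add: alpha_def axis_def)

text \<open>Write \<open>w = v u\<close> with \<open>u\<close> the longest possible alternating suffix in \<open>s\<close> and \<open>t\<close> of a reduced
  word of \<open>w\<close>. Then neither \<open>s\<close> nor \<open>t\<close> shortens \<open>v\<close>, and \<open>u\<close> maps \<open>\<alpha>\<^sub>s\<close> to a nonnegative combination
  of \<open>\<alpha>\<^sub>s\<close> and \<open>\<alpha>\<^sub>t\<close> because it is too short to be rewritten by a braid relation.\<close>

lemma ascent_nonneg: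
  assumes "w \<in> W" "\<not> len (w \<cdot> S s) < len w"
  shows "nonneg (snd w (alpha s))"
  using assms
proof (induction "len w" arbitrary: w s rule: less_induct)
  case less
  show ?case
  proof (cases "w = weyl_one")
    case True
    then show ?thesis by (simp add: nonneg_def alpha_nth)
  next
    case False
    obtain t where t: "Suc (len (w \<cdot> S t)) = len w"
      using len_descent[OF less.prems(1) False] .
    with less.prems have "s \<noteq> t" by auto
    define a where "a = - \<langle>H s, alpha t\<rangle>"
    define b where "b = - \<langle>H t, alpha s\<rangle>"
    have ab: "\<langle>H s, alpha t\<rangle> = - a" "\<langle>H t, alpha s\<rangle> = - b"
      by (simp_all add: a_def b_def)
    have ab0: "0 \<le> a" "0 \<le> b" "a = 0 \<longleftrightarrow> b = 0"
      using cartan_offdiag[of s t] cartan_offdiag[of t s] \<open>s \<noteq> t\<close> by (auto simp: a_def b_def)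
    define P where "P k \<longleftrightarrow> (\<exists>v\<in>W. w = v \<cdot> alt s t k \<and> len v + k = len w)" for k
    have P1: "P 1"
      unfolding P_def using t less.prems(1) by (intro bexI[of _ "w \<cdot> S t"]) (auto simp: W_mult)
    have bound: "\<forall>j. P j \<longrightarrow> j \<le> len w" by (auto simp: P_def)
    define k where "k = (GREATEST k. P k)"
    have "P k" unfolding k_def by (rule GreatestI_nat[of P, OF P1]) (use bound in blast)
    have "1 \<le> k" unfolding k_def by (rule Greatest_le_nat[of P, OF P1]) (use bound in blast)
    have "\<not> P (Suc k)"
      using Greatest_le_nat[of P "Suc k" "len w"] bound unfolding k_def by force
    from \<open>1 \<le> k\<close> obtain k' where k': "k = Suc k'" by (cases k) auto
    from \<open>P k\<close> obtain v where v: "v \<in> W" "w = v \<cdot> alt s t k" "len v + k = len w"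
      by (auto simp: P_def)
    have IH: "nonneg (snd v (alpha z))" if "\<not> len (v \<cdot> S z) < len v" for z
      using less.hyps[of v z] v that k' by simp
    \<comment> \<open>The letter \<open>z\<close> would extend the alternating suffix to the left,
      so shortening \<open>v\<close> by it contradicts the maximality of \<open>k\<close>.\<close>
    have 1: "\<not> len (v \<cdot> S z) < len v" if z: "z = (if even k then t else s)" for z
    proof
      assume "len (v \<cdot> S z) < len v"
      then have "Suc (len (v \<cdot> S z)) = len v"
        using len_mult_S_le[of "v \<cdot> S z" z] v(1) by (simp add: W_mult)
      moreover have "w = v \<cdot> S z \<cdot> alt s t (Suc k)"
        unfolding alt_Suc_front v(2) z weyl_mult_assoc by simp
      ultimately have "P (Suc k)"
        unfolding P_def using v(1,3) by (intro bexI[of _ "v \<cdot> S z"]) (auto simp: W_mult)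
      with \<open>\<not> P (Suc k)\<close> show False ..
    qed
    \<comment> \<open>Now \<open>z\<close> is the leftmost letter of the suffix itself: cancelling
      it would write \<open>w\<close> with fewer than \<open>len w\<close> letters.\<close>
    have 2: "\<not> len (v \<cdot> S z) < len v" if z: "z = (if even k then s else t)" for z
    proof
      assume *: "len (v \<cdot> S z) < len v"
      obtain js where js: "length js = k'" "alt s t k' = word js" using alt_word by blast
      have "w = v \<cdot> S z \<cdot> word js"
        unfolding v(2) k' alt_Suc_front js weyl_mult_assoc using z k' by simp
      then have "len w \<le> len (v \<cdot> S z) + k'"
        using len_mult_word_le[of "v \<cdot> S z" js] js v(1) by (simp add: W_mult)
      with * v(3) k' show False by simp
    qed
    have nn: "nonneg (snd v (alpha s))" "nonneg (snd v (alpha t))"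
      using IH[of s] IH[of t] 1 2 by (cases "even k"; simp)+
    obtain x y where xy: "0 \<le> x" "0 \<le> y" "snd (alt s t k) (alpha s) = x *s alpha s + y *s alpha t"
    proof (cases "4 \<le> a * b")
      case True
      then show thesis using alt_pos_infinite[OF ab ab0(1,2), of k] that by blast
    next
      case False
      then have "a * b < 4" by simp
      then obtain m :: nat where m: "(a, b, m) \<in> {(0,0,2), (1,1,3), (1,2,4), (2,1,4), (1,3,6), (3,1,6)}"
        "0 < m"
        by (rule cartan_small[OF ab0])
      have "k < m"
      proof (rule ccontr)
        assume "\<not> k < m"
        then obtain js where "length js < k" "alt s t k \<cdot> S s = word js"
          using alt_shorten[OF braid[OF ab m(1)] m(2), of k] by auto
        then have "len (w \<cdot> S s) < len v + k"
          using len_mult_word_le[OF v(1), of js] by (simp add: v(2) weyl_mult_assoc)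
        with v(3) less.prems(2) show False by simp
      qed
      then show thesis using alt_pos_finite[OF ab m(1)] that by blast
    qed
    have "snd w (alpha s) = x *s snd v (alpha s) + y *s snd v (alpha t)"
      using v(1) xy(3) by (simp add: v(2) W_snd_add W_snd_smult)
    then show ?thesis using nn xy(1,2) by (simp add: nonneg_def)
  qed
qed

lemma snd_S_alpha [simp]: "snd (S i) (alpha i) = - alpha i"
  by (simp add: snd_S vec_eq_iff)

text \<open>\<open>S s\<close> negates \<open>alpha s\<close>, and \<open>s\<close> is an ascent of
  \<open>w \<cdot> S s\<close>.\<close>

lemma descent_nonpos:
  assumes "w \<in> W" "len (w \<cdot> S s) < len w"
  shows "nonneg (- snd w (alpha s))"
  using ascent_nonneg[of "w \<cdot> S s" s] assms by (simp add: W_mult W_snd_uminus)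

section \<open>Real roots and their signs\<close>

abbreviation "R \<equiv> real_roots D"
abbreviation "Rp \<equiv> pos_roots D"

lemma pos_roots_iff: "\<gamma> \<in> Rp \<longleftrightarrow> \<gamma> \<in> R \<and> nonneg \<gamma>"
  by (simp add: pos_roots_def nonneg_def)

lemma real_rootE:
  assumes "\<gamma> \<in> R" obtains w i where "w \<in> W" "\<gamma> = snd w (alpha i)"
  using assms by (auto simp: real_roots_def)

lemma real_rootI: "w \<in> W \<Longrightarrow> snd w (alpha i) \<in> R"
  unfolding real_roots_def by blast

lemma alpha_real [simp]: "alpha i \<in> R"
  using real_rootI[OF weyl_group.one] by simp

lemma alpha_pos [simp]: "alpha i \<in> Rp"
  by (simp add: pos_roots_iff nonneg_def alpha_nth)

lemma W_real:
  assumes "w \<in> W" "\<gamma> \<in> R" shows "snd w \<gamma> \<in> R"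
proof -
  obtain u i where u: "u \<in> W" "\<gamma> = snd u (alpha i)" using real_rootE[OF assms(2)] .
  then show ?thesis using real_rootI[OF W_mult[OF assms(1) u(1)], of i] by simp
qed

lemma uminus_real:
  assumes "\<gamma> \<in> R" shows "- \<gamma> \<in> R"
proof -
  obtain u i where u: "u \<in> W" "\<gamma> = snd u (alpha i)" using real_rootE[OF assms] .
  then show ?thesis using real_rootI[OF W_mult[OF u(1) S_in_W, of i], of i] by (simp add: W_snd_uminus)
qed

lemma uminus_real_iff [simp]: "- \<gamma> \<in> R \<longleftrightarrow> \<gamma> \<in> R"
  using uminus_real[of \<gamma>] uminus_real[of "- \<gamma>"] by auto

lemma alpha_nonzero: "alpha i \<noteq> 0"
  by (metis alpha_nth zero_index zero_neq_one)

lemma real_nonzero: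
  assumes "\<gamma> \<in> R" shows "\<gamma> \<noteq> 0"
proof -
  obtain u i where u: "u \<in> W" "\<gamma> = snd u (alpha i)" using real_rootE[OF assms] .
  then show ?thesis using W_snd_inj[OF u(1), of "alpha i" 0] alpha_nonzero by (simp add: W_snd_zero)
qed

text \<open>The sign of \<open>snd u (alpha i)\<close> is decided by whether \<open>S i\<close>
  shortens \<open>u\<close>.\<close>

lemma real_cases:
  assumes "\<gamma> \<in> R" shows "\<gamma> \<in> Rp \<or> - \<gamma> \<in> Rp"
proof -
  obtain u i where u: "u \<in> W" "\<gamma> = snd u (alpha i)" using real_rootE[OF assms] .
  then show ?thesis
    using ascent_nonneg[OF u(1), of i] descent_nonpos[OF u(1), of i] assms by (auto simp: pos_roots_iff)
qed

lemma nonneg_antisym: "nonneg \<gamma> \<Longrightarrow> nonneg (- \<gamma>) \<Longrightarrow> \<gamma> = 0"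
  by (simp add: nonneg_def vec_eq_iff order_antisym)

lemma pos_not_neg: "\<gamma> \<in> Rp \<Longrightarrow> - \<gamma> \<notin> Rp"
  using nonneg_antisym real_nonzero by (auto simp: pos_roots_iff)

text \<open>A nontrivial element has a descent and so sends some simple root to a negative one. The
  conclusion is an equality of pairs: the action on the root lattice also controls the one on
  \<open>P\<close>.\<close>

lemma W_eq_one:
  assumes "v \<in> W" "\<And>j. nonneg (snd v (alpha j))" shows "v = weyl_one"
proof (rule ccontr)
  assume "v \<noteq> weyl_one"
  then obtain i where "Suc (len (v \<cdot> S i)) = len v" using len_descent assms(1) by blast
  then have "nonneg (- snd v (alpha i))" using descent_nonpos[OF assms(1), of i] by simp
  then have "snd v (alpha i) = 0" using nonneg_antisym assms(2) by blast
  then show False using real_nonzero real_rootI[OF assms(1)] by blast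
qed

text \<open>\<open>S i\<close> changes only the coordinate at \<open>i\<close>. If it made
  \<open>\<gamma>\<close> negative, all other coordinates would vanish, and the only positive real
  root proportional to \<open>alpha i\<close> is \<open>alpha i\<close> itself.\<close>

lemma S_pos:
  assumes "\<gamma> \<in> Rp" "\<gamma> \<noteq> alpha i" shows "snd (S i) \<gamma> \<in> Rp"
proof (rule ccontr)
  assume "snd (S i) \<gamma> \<notin> Rp"
  moreover have real: "\<gamma> \<in> R" using assms(1) by (simp add: pos_roots_iff)
  ultimately have "nonneg (- snd (S i) \<gamma>)"
    using real_cases[OF W_real[OF S_in_W real]] by (auto simp: pos_roots_iff)
  then have "\<gamma> $ j = 0" if "j \<noteq> i" for j
    using assms(1) that
    by (auto simp: pos_roots_iff nonneg_def snd_S alpha_nth intro!: antisym dest!: spec[of _ j] split: if_splits)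
  then have \<gamma>: "\<gamma> = \<gamma> $ i *s alpha i" by (auto simp: vec_eq_iff alpha_nth)
  obtain w j where w: "w \<in> W" "\<gamma> = snd w (alpha j)" using real_rootE[OF real] .
  then have "alpha j = snd (weyl_inverse w) \<gamma>" by simp
  also have "\<dots> = snd (weyl_inverse w) (\<gamma> $ i *s alpha i)" using \<gamma> by (rule arg_cong)
  finally have "alpha j = snd (weyl_inverse w) (\<gamma> $ i *s alpha i)" .
  \<comment> \<open>Comparing one coordinate shows that the integer \<open>\<gamma> $ i\<close>
    divides 1.\<close>
  then have "alpha j $ j = \<gamma> $ i * (snd (weyl_inverse w) (alpha i) $ j)"
    by (simp add: W_snd_smult W_inverse w(1))
  then have "1 = \<gamma> $ i * (snd (weyl_inverse w) (alpha i) $ j)"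
    by (simp add: alpha_nth)
  moreover have "0 \<le> \<gamma> $ i" using assms(1) by (simp add: pos_roots_iff nonneg_def)
  ultimately have "\<gamma> $ i = 1" by (metis zmult_eq_1_iff neg_0_le_iff_le not_one_le_zero)
  with \<gamma> have "\<gamma> = 1 *s alpha i" by metis
  with assms(2) show False by simp
qed

lemma S_pos_iff:
  assumes "\<gamma> \<in> R" "\<gamma> \<noteq> alpha i" "\<gamma> \<noteq> - alpha i"
  shows "snd (S i) \<gamma> \<in> Rp \<longleftrightarrow> \<gamma> \<in> Rp"
proof (cases "\<gamma> \<in> Rp")
  case True
  then show ?thesis using S_pos assms(2) by simp
next
  case False
  then have "- \<gamma> \<in> Rp" using real_cases[OF assms(1)] by blast
  moreover have "- \<gamma> \<noteq> alpha i" using assms(3) minus_minus[of \<gamma>] by metis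
  ultimately have "- snd (S i) \<gamma> \<in> Rp" using S_pos[of "- \<gamma>" i] by (simp add: W_snd_uminus)
  then show ?thesis using False pos_not_neg by blast
qed

section \<open>Coroots and reflections\<close>

lemma conjugate_S:
  assumes "u \<in> W"
  shows "fst (u \<cdot> S i \<cdot> weyl_inverse u) \<mu> = \<mu> - \<langle>\<mu>, snd u (alpha i)\<rangle> *s fst u (H i)"
    "snd (u \<cdot> S i \<cdot> weyl_inverse u) \<gamma> = \<gamma> - \<langle>fst u (H i), \<gamma>\<rangle> *s snd u (alpha i)"
  using assms
  by (simp_all add: fst_S snd_S W_fst_diff W_snd_diff W_fst_smult W_snd_smult
        W_pairing_right[OF assms] W_pairing_left[OF assms])

text \<open>The conjugate \<open>r\<close> of \<open>S i\<close> is a reflection along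
  \<open>alpha j\<close>, a priori with another coroot. Then \<open>r \<cdot> S j\<close> adds only
  multiples of \<open>alpha j\<close> to the other simple roots and fixes \<open>alpha j\<close>, so
  it keeps all simple roots positive and is trivial. Applying \<open>r = S j\<close> to
  \<open>H j\<close> compares the coroots.\<close>

lemma coroot_unique:
  assumes "u \<in> W" "snd u (alpha i) = alpha j" shows "fst u (H i) = H j"
proof -
  define r where "r = u \<cdot> S i \<cdot> weyl_inverse u"
  have r: "r \<in> W" "fst r \<mu> = \<mu> - \<langle>\<mu>, alpha j\<rangle> *s fst u (H i)"
    "snd r \<gamma> = \<gamma> - \<langle>fst u (H i), \<gamma>\<rangle> *s alpha j" for \<mu> \<gamma>
    using conjugate_S[OF assms(1), of i] assms unfolding r_def by (simp_all add: W_mult W_inverse)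
  have two: "\<langle>fst u (H i), alpha j\<rangle> = 2"
    using W_pairing[OF assms(1), of "H i" "alpha i"] assms(2) by simp
  have "nonneg (snd (r \<cdot> S j) (alpha k))" for k
  proof (cases "k = j")
    case True
    then show ?thesis
      by (simp add: r two W_snd_uminus pairing_simps nonneg_def alpha_nth)
  next
    case False
    then have "\<not> nonneg (- snd (r \<cdot> S j) (alpha k))"
      by (auto simp: nonneg_def r snd_S alpha_nth intro!: exI[of _ k])
    moreover have "snd (r \<cdot> S j) (alpha k) \<in> R" by (intro real_rootI W_mult r(1) S_in_W)
    ultimately show ?thesis using real_cases unfolding pos_roots_iff by blast
  qed
  then have "r \<cdot> S j = weyl_one" using r(1) by (intro W_eq_one W_mult) auto
  then have "r = S j" by (metis S_cancel_right weyl_mult_one(1))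
  then have "fst r (H j) = fst (S j) (H j)" by simp
  then show ?thesis by (simp add: r fst_S vec_eq_iff)
qed

text \<open>Two presentations of a root differ by a Weyl element carrying one simple root to
  another, so \<open>coroot_unique\<close> shows that the description in \<open>coroot\<close> is
  definite.\<close>

lemma coroot_eq:
  assumes "w \<in> W" shows "coroot D (snd w (alpha i)) = fst w (H i)"
  unfolding coroot_def
proof (rule the_equality)
  show "\<exists>v\<in>W. \<exists>j. snd w (alpha i) = snd v (alpha j) \<and> fst w (H i) = fst v (H j)"
    using assms by blast
next
  fix h assume "\<exists>v\<in>W. \<exists>j. snd w (alpha i) = snd v (alpha j) \<and> h = fst v (H j)"
  then obtain v j where v: "v \<in> W" "snd w (alpha i) = snd v (alpha j)" "h = fst v (H j)" by blast
  have "snd (weyl_inverse w \<cdot> v) (alpha j) = alpha i" using v(2)[symmetric] assms by simp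
  then have "fst (weyl_inverse w \<cdot> v) (H j) = H i"
    using coroot_unique[of "weyl_inverse w \<cdot> v"] v(1) assms by (simp add: W_mult W_inverse)
  then have "fst w (fst (weyl_inverse w) h) = fst w (H i)" using v(3) by simp
  then show "h = fst w (H i)" using assms by simp
qed

lemma reflection_in_W:
  assumes "\<beta> \<in> R" shows "reflection D \<beta> \<in> W"
proof -
  obtain w i where w: "w \<in> W" "\<beta> = snd w (alpha i)" using real_rootE[OF assms] .
  have "reflection D \<beta> = w \<cdot> S i \<cdot> weyl_inverse w"
    by (rule weyl_eqI) (simp_all only: conjugate_S[OF w(1)], simp_all add: reflection_def coroot_eq w)
  then show ?thesis using w by (simp add: W_mult W_inverse)
qed

lemma coroot_pairing:
  assumes "\<beta> \<in> R" shows "\<langle>coroot D \<beta>, \<beta>\<rangle> = 2"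
  using assms by (elim real_rootE) (simp add: coroot_eq W_pairing)

section \<open>Dominant coweights and inversions\<close>

lemma dominant_pos:
  assumes "dominant D \<mu>" "\<gamma> \<in> Rp" shows "0 \<le> \<langle>\<mu>, \<gamma>\<rangle>"
  using assms
  by (subst pairing_eq_sum_alpha) (auto intro!: sum_nonneg simp: dominant_def pos_roots_def)

text \<open>At a descent \<open>i\<close> of \<open>w\<close>, the root
  \<open>snd w (alpha i)\<close> is negative, so dominance of both coweights forces
  \<open>\<mu>\<close> to pair to 0 with \<open>alpha i\<close>. Hence \<open>S i\<close> fixes
  \<open>\<mu>\<close>, and \<open>w\<close> may be replaced by the shorter
  \<open>w \<cdot> S i\<close>.\<close>

lemma dominant_unique:
  assumes "w \<in> W" "dominant D \<mu>" "dominant D (fst w \<mu>)" shows "fst w \<mu> = \<mu>"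
  using assms
proof (induction "len w" arbitrary: w rule: less_induct)
  case less
  show ?case
  proof (cases "w = weyl_one")
    case False
    then obtain i where i: "Suc (len (w \<cdot> S i)) = len w" using len_descent less.prems(1) by blast
    then have "- snd w (alpha i) \<in> Rp"
      using descent_nonpos[OF less.prems(1), of i] real_rootI[OF less.prems(1)]
      by (simp add: pos_roots_iff)
    then have "\<langle>\<mu>, alpha i\<rangle> \<le> 0"
      using dominant_pos[OF less.prems(3)] W_pairing[OF less.prems(1), of \<mu> "alpha i"]
      by (fastforce simp: pairing_simps)
    moreover have "0 \<le> \<langle>\<mu>, alpha i\<rangle>" using less.prems(2) by (simp add: dominant_def)
    ultimately have *: "fst (S i) \<mu> = \<mu>" by (simp add: fst_S)
    then have "fst (w \<cdot> S i) \<mu> = \<mu>"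
      using less.prems i by (intro less.hyps) (auto simp: W_mult)
    then show ?thesis by (simp add: *)
  qed simp
qed

lemma dominant_rep_eq:
  assumes "v \<in> W" "dominant D (fst v \<mu>)" shows "dominant_rep D \<mu> = fst v \<mu>"
  unfolding dominant_rep_def
proof (rule the_equality)
  show "dominant D (fst v \<mu>) \<and> (\<exists>w\<in>W. fst v \<mu> = fst w \<mu>)" using assms by blast
next
  fix \<nu> assume "dominant D \<nu> \<and> (\<exists>w\<in>W. \<nu> = fst w \<mu>)"
  then obtain w where w: "w \<in> W" "dominant D (fst w \<mu>)" "\<nu> = fst w \<mu>" by blast
  have "fst (w \<cdot> weyl_inverse v) (fst v \<mu>) = fst w \<mu>" using assms(1) by simp
  then show "\<nu> = fst v \<mu>"
    using dominant_unique[of "w \<cdot> weyl_inverse v" "fst v \<mu>"] assms w by (simp add: W_mult W_inverse)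
qed

abbreviation "Inv \<equiv> weyl_inversions D"

lemma Inv_iff: "\<gamma> \<in> Inv w \<longleftrightarrow> \<gamma> \<in> Rp \<and> - snd w \<gamma> \<in> Rp"
  by (simp add: weyl_inversions_def)

text \<open>Apart from \<open>alpha i\<close> and its negative, \<open>S i\<close> preserves the
  sign of every root, so only the preimages of these two under \<open>w\<close> can change
  status.\<close>

lemma Inv_step:
  assumes "w \<in> W" "\<eta> = snd (weyl_inverse w) (alpha i)"
  shows "\<eta> \<in> Rp \<Longrightarrow> \<eta> \<notin> Inv w \<and> Inv (S i \<cdot> w) = insert \<eta> (Inv w)"
    and "- \<eta> \<in> Rp \<Longrightarrow> - \<eta> \<in> Inv w \<and> Inv (S i \<cdot> w) = Inv w - {- \<eta>}"
proof -
  have w\<eta>: "snd w \<eta> = alpha i" using assms by simp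
  have other: "\<gamma> \<in> Inv (S i \<cdot> w) \<longleftrightarrow> \<gamma> \<in> Inv w" if "\<gamma> \<noteq> \<eta>" "\<gamma> \<noteq> - \<eta>" for \<gamma>
  proof -
    have "snd w \<gamma> \<noteq> alpha i" "snd w \<gamma> \<noteq> - alpha i"
      using that W_snd_inj[OF assms(1)] W_snd_uminus[OF assms(1)] w\<eta> by metis+
    then have "snd (S i) (- snd w \<gamma>) \<in> Rp \<longleftrightarrow> - snd w \<gamma> \<in> Rp" if "\<gamma> \<in> R"
      using that by (intro S_pos_iff) (auto simp: W_real assms(1) minus_equation_iff[of _ "alpha i"])
    then show ?thesis by (auto simp: Inv_iff W_snd_uminus pos_roots_iff[of \<gamma>])
  qed
  have "\<eta> \<noteq> 0" using w\<eta> alpha_nonzero[of i] W_snd_zero[OF assms(1)] by metis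
  then have eta: "\<eta> \<noteq> - \<eta>" by (auto simp: vec_eq_iff)
  have 1: "\<eta> \<notin> Inv w" "- \<eta> \<notin> Inv (S i \<cdot> w)"
    using assms(1) pos_not_neg[OF alpha_pos] by (simp_all add: Inv_iff w\<eta> W_snd_uminus)
  show "\<eta> \<notin> Inv w \<and> Inv (S i \<cdot> w) = insert \<eta> (Inv w)" if "\<eta> \<in> Rp"
  proof -
    have "\<eta> \<in> Inv (S i \<cdot> w)" "- \<eta> \<notin> Inv w"
      using that pos_not_neg[OF that] by (simp_all add: Inv_iff w\<eta>)
    then have "\<gamma> \<in> Inv (S i \<cdot> w) \<longleftrightarrow> \<gamma> \<in> insert \<eta> (Inv w)" for \<gamma>
      using 1 other[of \<gamma>] eta by (cases "\<gamma> = \<eta>"; cases "\<gamma> = - \<eta>") simp_all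
    then show ?thesis using 1 by blast
  qed
  show "- \<eta> \<in> Inv w \<and> Inv (S i \<cdot> w) = Inv w - {- \<eta>}" if "- \<eta> \<in> Rp"
  proof -
    have "- \<eta> \<in> Inv w" "\<eta> \<notin> Inv (S i \<cdot> w)"
      using that assms(1) pos_not_neg[OF that] by (simp_all add: Inv_iff w\<eta> W_snd_uminus)
    then have "\<gamma> \<in> Inv (S i \<cdot> w) \<longleftrightarrow> \<gamma> \<in> Inv w - {- \<eta>}" for \<gamma>
      using 1 other[of \<gamma>] eta by (cases "\<gamma> = \<eta>"; cases "\<gamma> = - \<eta>") simp_all
    then show ?thesis using \<open>- \<eta> \<in> Inv w\<close> by blast
  qed
qed

lemma finite_Inv: "w \<in> W \<Longrightarrow> finite (Inv w)"
proof (induction rule: weyl_group.induct)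
  case one
  have "Inv weyl_one = {}" using pos_not_neg by (auto simp: weyl_inversions_def)
  then show ?case by simp
next
  case (step w i)
  define \<eta> where "\<eta> = snd (weyl_inverse w) (alpha i)"
  have "\<eta> \<in> R" unfolding \<eta>_def by (intro real_rootI W_inverse step.hyps)
  then consider "\<eta> \<in> Rp" | "- \<eta> \<in> Rp" using real_cases by blast
  then show ?case using Inv_step[OF step.hyps \<eta>_def] step.IH by cases auto
qed

section \<open>Affine roots\<close>

text \<open>This agrees with \<open>aff_pos\<close> on affine real roots, but also makes sense for their sums.\<close>

definition lexpos :: "'i affine_root \<Rightarrow> bool" where
  "lexpos a \<longleftrightarrow> 0 < snd a \<or> snd a = 0 \<and> nonneg (fst a) \<and> fst a \<noteq> 0"

lemma aff_pos_lexpos: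
  assumes "fst a \<in> R" shows "aff_pos D a \<longleftrightarrow> lexpos a"
  using real_cases[OF assms] pos_not_neg[of "fst a"] real_nonzero[OF assms] assms
  by (auto simp: aff_pos_def lexpos_def pos_roots_iff)

text \<open>At level 0, a sum of nonnegative vectors vanishes only if both do.\<close>

lemma lexpos_add:
  assumes "lexpos a" "lexpos b" shows "lexpos (a + b)"
proof -
  have "fst a + fst b \<noteq> 0" if "nonneg (fst a)" "nonneg (fst b)" "fst a \<noteq> 0"
    using that by (metis add_eq_0_iff nonneg_antisym)
  then show ?thesis using assms by (auto simp: lexpos_def nonneg_def)
qed

lemma lexpos_scale:
  assumes "lexpos (v, m)" "0 < k" shows "lexpos (k *s v, k * m)"
  using assms by (auto simp: lexpos_def nonneg_def vec_eq_iff)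

lemma aff_pos_uminus:
  assumes "fst a \<in> R" shows "aff_pos D (- a) \<longleftrightarrow> \<not> aff_pos D a"
  using real_cases[OF assms] pos_not_neg[of "fst a"] by (auto simp: aff_pos_def)

lemma fst_aff_act [simp]: "fst (aff_act D x a) = snd (snd x) (fst a)"
  by (simp add: aff_act_def Let_def)

lemma aff_act_pair: "aff_act D (\<mu>, w) (\<gamma>, m) = (snd w \<gamma>, m + \<langle>\<mu>, snd w \<gamma>\<rangle>)"
  by (simp add: aff_act_def Let_def)

lemma aff_act_uminus: "snd x \<in> W \<Longrightarrow> aff_act D x (- a) = - aff_act D x a"
  by (simp add: aff_act_def Let_def W_snd_uminus pairing_simps prod_eq_iff)

lemma aff_act_add: "snd x \<in> W \<Longrightarrow> aff_act D x (a + b) = aff_act D x a + aff_act D x b"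
  by (simp add: aff_act_def Let_def W_snd_add pairing_simps prod_eq_iff)

lemma aff_act_scale:
  "snd x \<in> W \<Longrightarrow> aff_act D x (k *s v, k * m)
    = (k *s fst (aff_act D x (v, m)), k * snd (aff_act D x (v, m)))"
  by (simp add: aff_act_def Let_def W_snd_smult pairing_simps algebra_simps)

lemma aff_act_mult:
  assumes "snd x \<in> W" shows "aff_act D (aff_mult x y) a = aff_act D x (aff_act D y a)"
  by (simp add: aff_act_def Let_def aff_mult_def pairing_simps W_pairing[OF assms])

text \<open>The negatives of the inversions of \<open>x\<close> with vector part in \<open>- E\<close>.\<close>

definition flips :: "('n, 'i) affine_weyl \<Rightarrow> (int ^ 'i) set \<Rightarrow> 'i affine_root set" where
  "flips x E = {a \<in> E \<times> UNIV. \<not> aff_pos D a \<and> aff_pos D (aff_act D x a)}"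

text \<open>Unlike \<open>sgn\<close>, the value at 0 is 1, since the length function counts a root
  with pairing 0 positively.\<close>

definition sg :: "int \<Rightarrow> int" where
  "sg p = (if 0 \<le> p then 1 else - 1)"

text \<open>\<open>G\<close> picks from each pair of opposite roots the one that \<open>w\<close>
  makes positive. The levels over the two roots of a pair form two integer intervals, at least one
  of them empty.\<close>

lemma card_flips:
  assumes w: "w \<in> W" and E: "finite E" "E \<subseteq> R" "\<And>\<gamma>. \<gamma> \<in> E \<Longrightarrow> - \<gamma> \<in> E"
  shows "finite (flips (\<mu>, w) E)"
    and "int (card (flips (\<mu>, w) E)) = (\<Sum>\<alpha>\<in>snd w ` E \<inter> Rp.
      \<bar>\<langle>\<mu>, \<alpha>\<rangle>\<bar> + (if \<alpha> \<in> Inv (weyl_inverse w) then sg \<langle>\<mu>, \<alpha>\<rangle> else 0))"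
proof -
  define fib where "fib \<gamma> = {m. \<not> aff_pos D (\<gamma>, m) \<and> aff_pos D (aff_act D (\<mu>, w) (\<gamma>, m))}" for \<gamma>
  define G where "G = {\<gamma> \<in> E. snd w \<gamma> \<in> Rp}"
  let ?f = "\<lambda>\<alpha>. \<bar>\<langle>\<mu>, \<alpha>\<rangle>\<bar> + (if \<alpha> \<in> Inv (weyl_inverse w) then sg \<langle>\<mu>, \<alpha>\<rangle> else 0)"
  have flips: "flips (\<mu>, w) E = Sigma E fib"
    by (auto simp: flips_def fib_def)
  have fib: "finite (fib \<gamma>) \<and> finite (fib (- \<gamma>)) \<and>
      int (card (fib \<gamma>)) + int (card (fib (- \<gamma>))) = ?f (snd w \<gamma>)" if "\<gamma> \<in> G" for \<gamma>
  proof -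
    define p where "p = \<langle>\<mu>, snd w \<gamma>\<rangle>"
    have \<gamma>: "\<gamma> \<in> R" "snd w \<gamma> \<in> Rp" using that E(2) by (auto simp: G_def)
    have \<gamma>': "- snd w \<gamma> \<notin> Rp" using pos_not_neg \<gamma>(2) by blast
    show ?thesis
    proof (cases "\<gamma> \<in> Rp")
      case True
      then have "- \<gamma> \<notin> Rp" using pos_not_neg by blast
      then have "fib \<gamma> = {- p..<0}" "fib (- \<gamma>) = {p<..0}" "snd w \<gamma> \<notin> Inv (weyl_inverse w)"
        using True \<gamma> \<gamma>' w
        by (auto simp: fib_def aff_pos_def aff_act_pair W_snd_uminus p_def pairing_simps Inv_iff)
      then show ?thesis by (simp flip: p_def)
    next
      case False
      then have "- \<gamma> \<in> Rp" using real_cases \<gamma>(1) by blast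
      \<comment> \<open>A negative root at level 0 is a negative affine root, so compared with the
        case above the end 0 moves from the second interval to the first. This shifts the total by
        \<open>sg p\<close>.\<close>
      then have "fib \<gamma> = {- p..0}" "fib (- \<gamma>) = {p<..<0}" "snd w \<gamma> \<in> Inv (weyl_inverse w)"
        using False \<gamma> \<gamma>' w
        by (auto simp: fib_def aff_pos_def aff_act_pair W_snd_uminus p_def pairing_simps Inv_iff)
      then show ?thesis by (simp add: sg_def flip: p_def)
    qed
  qed
  have EG: "E = G \<union> uminus ` G"
  proof (intro equalityI subsetI)
    fix \<gamma> assume \<gamma>: "\<gamma> \<in> E"
    then have "snd w \<gamma> \<in> Rp \<or> snd w (- \<gamma>) \<in> Rp"
      using real_cases[OF W_real[OF w]] E(2) by (auto simp: W_snd_uminus w)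
    then show "\<gamma> \<in> G \<union> uminus ` G"
      using \<gamma> E(3)[OF \<gamma>] unfolding G_def by (metis (mono_tags) UnCI image_eqI mem_Collect_eq minus_minus)
  qed (use E(3) in \<open>auto simp: G_def\<close>)
  have disj: "G \<inter> uminus ` G = {}"
    using pos_not_neg by (auto simp: G_def W_snd_uminus w)
  have "finite G" using E(1) by (simp add: G_def)
  have fin: "finite (fib \<gamma>)" if "\<gamma> \<in> E" for \<gamma> using that fib EG by auto
  show "finite (flips (\<mu>, w) E)" unfolding flips using E(1) fin by blast
  have "int (card (flips (\<mu>, w) E)) = (\<Sum>\<gamma>\<in>E. int (card (fib \<gamma>)))"
    unfolding flips using E(1) fin by (subst card_SigmaI) auto
  also have "\<dots> = (\<Sum>\<gamma>\<in>G. int (card (fib \<gamma>))) + (\<Sum>\<gamma>\<in>uminus ` G. int (card (fib \<gamma>)))"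
    unfolding EG using \<open>finite G\<close> disj by (intro sum.union_disjoint) auto
  also have "(\<Sum>\<gamma>\<in>uminus ` G. int (card (fib \<gamma>))) = (\<Sum>\<gamma>\<in>G. int (card (fib (- \<gamma>))))"
    by (subst sum.reindex) (auto simp: inj_on_def)
  also have "(\<Sum>\<gamma>\<in>G. int (card (fib \<gamma>))) + (\<Sum>\<gamma>\<in>G. int (card (fib (- \<gamma>)))) = (\<Sum>\<gamma>\<in>G. ?f (snd w \<gamma>))"
    unfolding sum.distrib[symmetric] using fib by (intro sum.cong) auto
  also have "\<dots> = (\<Sum>\<alpha>\<in>snd w ` G. ?f \<alpha>)"
    by (subst sum.reindex) (auto simp: inj_on_def W_snd_inj w)
  also have "snd w ` G = snd w ` E \<inter> Rp" by (auto simp: G_def)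
  finally show "int (card (flips (\<mu>, w) E)) = (\<Sum>\<alpha>\<in>snd w ` E \<inter> Rp. ?f \<alpha>)" .
qed

section \<open>The affine reflection of a fixed positive root\<close>

context
  fixes \<beta> :: "int ^ 'i" and n :: int
  assumes \<beta>: "\<beta> \<in> Rp"
begin

private abbreviation "r \<equiv> reflection D \<beta>"
private abbreviation "s \<equiv> aff_reflection D \<beta> n"

lemma \<beta>_real: "\<beta> \<in> R"
  using \<beta> by (simp add: pos_roots_iff)

lemma r_W: "r \<in> W"
  using reflection_in_W[OF \<beta>_real] .

lemma fst_r: "fst r \<mu> = \<mu> - \<langle>\<mu>, \<beta>\<rangle> *s coroot D \<beta>"
  by (simp add: reflection_def)

lemma snd_r: "snd r \<gamma> = \<gamma> - \<langle>coroot D \<beta>, \<gamma>\<rangle> *s \<beta>"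
  by (simp add: reflection_def)

lemma r_coroot: "fst r (coroot D \<beta>) = - coroot D \<beta>"
  by (simp add: fst_r coroot_pairing \<beta>_real vec_eq_iff)

lemma r_square: "r \<cdot> r = weyl_one"
  by (rule weyl_eqI)
    (simp_all add: fst_r snd_r pairing_simps coroot_pairing \<beta>_real vec_eq_iff algebra_simps)

lemma r_involution [simp]: "snd r (snd r \<gamma>) = \<gamma>"
  using r_square by (metis snd_weyl_mult weyl_one_apply(2))

lemma s_act: "aff_act D s (\<gamma>, m)
    = (\<gamma> - \<langle>coroot D \<beta>, \<gamma>\<rangle> *s \<beta>, m - \<langle>coroot D \<beta>, \<gamma>\<rangle> * n)"
  by (simp add: aff_reflection_def aff_act_pair snd_r pairing_simps coroot_pairing \<beta>_real algebra_simps)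

lemma snd_s [simp]: "snd s = r"
  by (simp add: aff_reflection_def)

lemma s_involution [simp]: "aff_act D s (aff_act D s a) = a"
  by (cases a) (simp add: s_act pairing_simps coroot_pairing \<beta>_real algebra_simps vec_eq_iff)

lemma mult_s_s:
  assumes "snd x \<in> W" shows "aff_mult (aff_mult x s) s = x"
proof -
  let ?c = "n *s coroot D \<beta>"
  have "?c + fst r ?c = 0" by (simp add: W_fst_smult r_W r_coroot vec_eq_iff)
  then have "fst (snd x) ?c + fst (snd x) (fst r ?c) = 0"
    using W_fst_add[OF assms, of ?c "fst r ?c"] W_fst_diff[OF assms, of 0 0] by simp
  then show ?thesis
    by (simp add: aff_mult_def aff_reflection_def weyl_mult_assoc r_square prod_eq_iff)
qed

text \<open>The sign \<open>e\<close> treats both cases of \<open>bracket\<close> uniformly; it is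
  its own inverse.\<close>

lemma bracket_cases:
  obtains e where "e * e = 1" "bracket \<beta> n = (e *s \<beta>, e * n)"
  by (rule that[of "if 0 \<le> n then 1 else - 1"]) (auto simp: bracket_def vec_eq_iff)

lemma bracket_root: "fst (bracket \<beta> n) \<in> R"
  using \<beta>_real by (simp add: bracket_def)

lemma bracket_pos: "aff_pos D (bracket \<beta> n)"
  using \<beta> by (simp add: bracket_def aff_pos_def)

lemma s_bracket: "aff_act D s (bracket \<beta> n) = - bracket \<beta> n"
  by (simp add: bracket_def s_act pairing_simps coroot_pairing \<beta>_real vec_eq_iff)

definition cover_set :: "('n, 'i) affine_weyl \<Rightarrow> 'i affine_root set" where
  "cover_set x = {a \<in> aff_inversions D s.
     aff_pos D (aff_act D x a) \<and> aff_pos D (aff_act D x (- aff_act D s a))}"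

text \<open>Negation reverses the sign of an affine root, so membership depends only on the signs of
  \<open>a\<close> and its images under \<open>s\<close>, \<open>x\<close> and
  \<open>x s\<close>.\<close>

lemma cover_set_iff:
  assumes x: "snd x \<in> W"
  shows "a \<in> cover_set x \<longleftrightarrow> fst a \<in> R \<and> aff_pos D a \<and> \<not> aff_pos D (aff_act D s a) \<and>
    aff_pos D (aff_act D x a) \<and> \<not> aff_pos D (aff_act D x (aff_act D s a))"
proof -
  have "fst (aff_act D s a) \<in> R" "fst (aff_act D x (aff_act D s a)) \<in> R" if "fst a \<in> R"
    using that by (simp_all add: W_real r_W x)
  then show ?thesis
    by (cases a) (auto simp: cover_set_def aff_inversions_def aff_neg_def pos_affine_roots_def
        affine_roots_def aff_act_uminus x aff_pos_uminus mem_Times_iff)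
qed

text \<open>Since \<open>s\<close> negates \<open>bracket \<beta> n\<close>, this root is always
  counted; this makes the increase of the length strict.\<close>

lemma bracket_in_cover_set:
  assumes "snd x \<in> W" "aff_pos D (aff_act D x (bracket \<beta> n))"
  shows "bracket \<beta> n \<in> cover_set x"
  using assms bracket_root bracket_pos
  by (simp add: cover_set_iff s_bracket aff_act_uminus aff_pos_uminus W_real)

text \<open>The difference of \<open>a\<close> and its image under \<open>s\<close> is a multiple
  \<open>k\<close> of \<open>bracket \<beta> n\<close>. As \<open>s\<close> makes \<open>a\<close>
  negative, \<open>k\<close> is positive; applying \<open>x\<close> then writes the image of
  \<open>a\<close> as a sum of two positive vectors. The multiple need not be a root, hence the use
  of \<open>lexpos\<close>.\<close>

lemma sum_pos:
  assumes x: "snd x \<in> W" and b: "aff_pos D (aff_act D x (bracket \<beta> n))"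
    and a: "fst a \<in> R" "aff_pos D a" "\<not> aff_pos D (aff_act D s a)" "aff_pos D (aff_act D x (aff_act D s a))"
  shows "aff_pos D (aff_act D x a)"
proof -
  obtain e where e: "e * e = 1" "bracket \<beta> n = (e *s \<beta>, e * n)" by (rule bracket_cases)
  define k where "k = \<langle>coroot D \<beta>, fst a\<rangle> * e"
  have "k * e = \<langle>coroot D \<beta>, fst a\<rangle>" using e(1) by (simp add: k_def mult.assoc)
  then have a_eq: "a = aff_act D s a + (k *s (e *s \<beta>), k * (e * n))"
    by (cases a) (simp add: s_act flip: mult.assoc)
  have real: "fst (aff_act D s a) \<in> R" "fst (aff_act D x (aff_act D s a)) \<in> R" "fst (aff_act D x a) \<in> R"
    using a(1) by (simp_all add: W_real r_W x)
  have lex_b: "lexpos (e *s \<beta>, e * n)"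
    using bracket_pos aff_pos_lexpos[OF bracket_root] by (simp add: e(2))
  have lex_xb: "lexpos (aff_act D x (e *s \<beta>, e * n))"
    using b aff_pos_lexpos[of "aff_act D x (bracket \<beta> n)"] bracket_root
    by (simp add: e(2) W_real x)
  have lex_a: "lexpos a" "\<not> lexpos (aff_act D s a)" "lexpos (aff_act D x (aff_act D s a))"
    using a real by (simp_all add: aff_pos_lexpos)
  have "0 < k"
  proof (rule ccontr)
    assume "\<not> 0 < k"
    then consider "k = 0" | "0 < - k" by linarith
    then show False
    proof cases
      case 1
      then show ?thesis using a_eq lex_a(1,2) by (simp flip: zero_prod_def)
    next
      case 2
      have "aff_act D s a = a + ((- k) *s (e *s \<beta>), (- k) * (e * n))"
        using a_eq by (simp add: prod_eq_iff vec_eq_iff)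
      then show ?thesis using lexpos_add[OF lex_a(1) lexpos_scale[OF lex_b 2]] lex_a(2) by simp
    qed
  qed
  have "aff_act D x a = aff_act D x (aff_act D s a) + aff_act D x (k *s (e *s \<beta>), k * (e * n))"
    using a_eq aff_act_add[OF x] by metis
  moreover have "lexpos (aff_act D x (k *s (e *s \<beta>), k * (e * n)))"
    unfolding aff_act_scale[OF x, of k "e *s \<beta>" "e * n"]
    by (rule lexpos_scale[OF _ \<open>0 < k\<close>]) (simp only: prod.collapse lex_xb)
  ultimately show ?thesis
    using lexpos_add lex_a(3) real(3) by (simp add: aff_pos_lexpos)
qed

text \<open>After transport by \<open>s\<close>, the flips of \<open>x s\<close> split into
  \<open>X\<close> and \<open>Z\<close>, while those of \<open>x\<close> split into
  \<open>Y'\<close> and \<open>Z\<close>. The common part cancels, \<open>s\<close> maps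
  \<open>Y'\<close> onto \<open>Y\<close>, and \<open>sum_pos\<close> puts \<open>Y\<close> inside
  \<open>X\<close>; what remains is \<open>X - Y\<close>.\<close>

lemma card_cover_set:
  assumes x: "snd x \<in> W" and b: "aff_pos D (aff_act D x (bracket \<beta> n))"
    and E: "E \<subseteq> R" "\<And>\<gamma>. \<gamma> \<in> E \<Longrightarrow> snd r \<gamma> \<in> E"
    and fin: "finite (flips x E)" "finite (flips (aff_mult x s) E)"
  shows "finite (cover_set x \<inter> E \<times> UNIV)"
    "int (card (flips (aff_mult x s) E)) - int (card (flips x E)) = int (card (cover_set x \<inter> E \<times> UNIV))"
proof -
  let ?P = "aff_pos D" and ?s = "aff_act D s" and ?x = "aff_act D x"
  have inj: "inj_on ?s A" for A by (metis inj_onI s_involution)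
  have K: "?s a \<in> E \<times> UNIV \<longleftrightarrow> a \<in> E \<times> UNIV" for a
    using E(2)[of "fst a"] E(2)[of "snd r (fst a)"] by (auto simp: mem_Times_iff)
  have s_image: "?s ` {a \<in> E \<times> UNIV. Q a} = {a \<in> E \<times> UNIV. Q (?s a)}" for Q
  proof (intro equalityI subsetI)
    fix a assume "a \<in> {a \<in> E \<times> UNIV. Q (?s a)}"
    then have "?s a \<in> {a \<in> E \<times> UNIV. Q a}" using K by simp
    then have "?s (?s a) \<in> ?s ` {a \<in> E \<times> UNIV. Q a}" by (rule imageI)
    then show "a \<in> ?s ` {a \<in> E \<times> UNIV. Q a}" by (simp only: s_involution)
  next
    fix a assume "a \<in> ?s ` {a \<in> E \<times> UNIV. Q a}"
    then obtain a' where a': "a' \<in> E \<times> UNIV" "Q a'" "a = ?s a'" by blast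
    then show "a \<in> {a \<in> E \<times> UNIV. Q (?s a)}" using K[of a'] by simp
  qed
  define X where "X = {a \<in> E \<times> UNIV. ?P a \<and> \<not> ?P (?s a) \<and> ?P (?x a)}"
  define Y where "Y = {a \<in> E \<times> UNIV. ?P a \<and> \<not> ?P (?s a) \<and> ?P (?x (?s a))}"
  define Y' where "Y' = {a \<in> E \<times> UNIV. \<not> ?P a \<and> ?P (?s a) \<and> ?P (?x a)}"
  define Z where "Z = {a \<in> E \<times> UNIV. \<not> ?P a \<and> \<not> ?P (?s a) \<and> ?P (?x a)}"
  have 1: "?s ` flips (aff_mult x s) E = X \<union> Z"
    unfolding flips_def s_image aff_act_mult[OF x] X_def Z_def by auto
  have 2: "flips x E = Y' \<union> Z"
    unfolding flips_def Y'_def Z_def by auto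
  have 3: "?s ` Y' = Y"
    unfolding Y'_def Y_def s_image by auto
  have finite: "finite X" "finite Z" "finite Y'"
    using fin 2 finite_imageI[OF fin(2), of ?s] unfolding 1 by auto
  have "card (flips (aff_mult x s) E) = card (X \<union> Z)"
    using card_image[OF inj, of "flips (aff_mult x s) E"] unfolding 1 by simp
  also have "\<dots> = card X + card Z"
    using finite by (intro card_Un_disjoint) (auto simp: X_def Z_def)
  finally have 4: "card (flips (aff_mult x s) E) = card X + card Z" .
  have 5: "card (flips x E) = card Y' + card Z"
    unfolding 2 using finite by (intro card_Un_disjoint) (auto simp: Y'_def Z_def)
  have 6: "card Y = card Y'"
    using card_image[OF inj, of Y'] unfolding 3 .
  have "Y \<subseteq> X"
    unfolding X_def Y_def using sum_pos[OF x b] E(1) by auto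
  have XY: "cover_set x \<inter> E \<times> UNIV = X - Y"
    using E(1) by (auto simp: cover_set_iff[OF x] X_def Y_def)
  show "finite (cover_set x \<inter> E \<times> UNIV)" unfolding XY using finite by simp
  have "card (X - Y) = card X - card Y" "card Y \<le> card X"
    using finite \<open>Y \<subseteq> X\<close> by (auto intro: card_Diff_subset finite_subset card_mono)
  then show "int (card (flips (aff_mult x s) E)) - int (card (flips x E)) = int (card (cover_set x \<inter> E \<times> UNIV))"
    unfolding XY using 4 5 6 by simp
qed

end

end

section \<open>Height and length\<close>

lemma weight_pairing_diff: "weight_pairing (x - y) \<phi> = weight_pairing x \<phi> - weight_pairing y \<phi>"
  by (simp add: weight_pairing_def algebra_simps sum_subtractf)

lemma weight_pairing_add: "weight_pairing (x + y) \<phi> = weight_pairing x \<phi> + weight_pairing y \<phi>"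
  by (simp add: weight_pairing_def algebra_simps sum.distrib)

lemma weight_pairing_smult: "weight_pairing (c *s x) \<phi> = of_int c * weight_pairing x \<phi>"
  by (simp add: weight_pairing_def algebra_simps sum_distrib_left)

lemma weight_pairing_coroot:
  assumes "is_rho D \<rho>" shows "weight_pairing (simple_coroot D i) \<rho> = 1"
proof -
  obtain \<Lambda> where L: "fundamental_weights D \<Lambda>" "\<rho> = (\<Sum>i\<in>UNIV. \<Lambda> i)"
    using assms by (auto simp: is_rho_def)
  have "weight_pairing (simple_coroot D i) \<rho> = (\<Sum>j\<in>UNIV. weight_pairing (simple_coroot D i) (\<Lambda> j))"
    unfolding weight_pairing_def L(2) sum_component sum_distrib_left by (rule sum.swap)
  also have "\<dots> = 1" using L(1) by (simp add: fundamental_weights_def)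
  finally show ?thesis .
qed

locale kac_moody_rho = kac_moody D
  for D :: "('n::finite, 'i::finite) root_datum" +
  fixes \<rho> :: "real ^ 'n"
  assumes rho: "is_rho D \<rho>"
begin

text \<open>A further factor \<open>S i\<close> lowers the height by the pairing of
  \<open>\<mu>\<close> with \<open>\<eta>\<close>. The inversion set gains \<open>\<eta>\<close> or
  loses its negative, and either changes the sum by the same amount.\<close>

lemma height_act:
  assumes "w \<in> W"
  shows "weight_pairing (fst w \<mu>) \<rho> = weight_pairing \<mu> \<rho> - of_int (\<Sum>\<delta>\<in>Inv w. \<langle>\<mu>, \<delta>\<rangle>)"
  using assms
proof (induction rule: weyl_group.induct)
  case one
  have "Inv weyl_one = {}" using pos_not_neg by (auto simp: weyl_inversions_def)
  then show ?case by simp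
next
  case (step w i)
  define \<eta> where "\<eta> = snd (weyl_inverse w) (alpha i)"
  note st = Inv_step[OF step.hyps \<eta>_def]
  have "\<eta> \<in> R" unfolding \<eta>_def by (intro real_rootI W_inverse step.hyps)
  have "(\<Sum>\<delta>\<in>Inv (S i \<cdot> w). \<langle>\<mu>, \<delta>\<rangle>) = (\<Sum>\<delta>\<in>Inv w. \<langle>\<mu>, \<delta>\<rangle>) + \<langle>\<mu>, \<eta>\<rangle>"
  proof (cases "\<eta> \<in> Rp")
    case True
    then show ?thesis using st(1) finite_Inv[OF step.hyps] by simp
  next
    case False
    then have "- \<eta> \<in> Rp" using real_cases[OF \<open>\<eta> \<in> R\<close>] by blast
    then show ?thesis
      using st(2) finite_Inv[OF step.hyps] by (simp add: sum_diff1 pairing_simps)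
  qed
  moreover have "weight_pairing (fst (S i \<cdot> w) \<mu>) \<rho> = weight_pairing (fst w \<mu>) \<rho> - of_int \<langle>\<mu>, \<eta>\<rangle>"
    unfolding \<eta>_def W_pairing_left[OF step.hyps, symmetric]
    by (simp add: fst_S weight_pairing_diff weight_pairing_smult weight_pairing_coroot[OF rho])
  ultimately show ?case using step.IH by simp
qed

text \<open>Infinite sums over positive roots are replaced by sums over any large enough finite
  \<open>F\<close>. If \<open>v\<close> makes \<open>\<mu>\<close> dominant, the positive roots
  outside \<open>Inv v\<close> pair nonnegatively with \<open>\<mu>\<close> and contribute nothing
  to the first sum.\<close>

lemma length_formula:
  assumes "(\<mu>, w) \<in> W_tits D"
  obtains B where "finite B" "B \<subseteq> Rp"
    "\<forall>F. finite F \<and> F \<subseteq> Rp \<and> B \<subseteq> F \<longrightarrow>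
      aff_length D \<rho> (\<mu>, w) = \<lfloor>2 * weight_pairing \<mu> \<rho>\<rfloor> + (\<Sum>\<alpha>\<in>F. \<bar>\<langle>\<mu>, \<alpha>\<rangle>\<bar> - \<langle>\<mu>, \<alpha>\<rangle>)
        + (\<Sum>\<alpha>\<in>F. if \<alpha> \<in> Inv (weyl_inverse w) then sg \<langle>\<mu>, \<alpha>\<rangle> else 0)"
proof -
  have w: "w \<in> W" using assms by (simp add: W_tits_def)
  obtain v where v: "v \<in> W" "dominant D (fst v \<mu>)"
    using assms by (auto simp: W_tits_def tits_cone_def)
  let ?I = "Inv (weyl_inverse w)"
  have fin: "finite (Inv v)" "finite ?I" using finite_Inv v(1) W_inverse(1)[OF w] by auto
  have "weight_pairing \<nu> (2 *\<^sub>R \<rho>) = 2 * weight_pairing \<nu> \<rho>" for \<nu> :: "int ^ 'n"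
    by (simp add: weight_pairing_def sum_distrib_left algebra_simps)
  \<comment> \<open>Twice the change of height is an even integer, so it leaves the floor even if
    the height of \<open>\<mu>\<close> is not an integer.\<close>
  then have "two_ht \<rho> (dominant_rep D \<mu>) = \<lfloor>2 * weight_pairing \<mu> \<rho> - of_int (2 * (\<Sum>\<delta>\<in>Inv v. \<langle>\<mu>, \<delta>\<rangle>))\<rfloor>"
    by (simp add: two_ht_def dominant_rep_eq[OF v] height_act[OF v(1)])
  then have ht: "two_ht \<rho> (dominant_rep D \<mu>) = \<lfloor>2 * weight_pairing \<mu> \<rho>\<rfloor> - 2 * (\<Sum>\<delta>\<in>Inv v. \<langle>\<mu>, \<delta>\<rangle>)"
    unfolding floor_diff_of_int .
  have pair_v: "\<langle>\<mu>, \<alpha>\<rangle> = \<langle>fst v \<mu>, snd v \<alpha>\<rangle>" for \<alpha> using W_pairing[OF v(1)] by simp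
  have neg: "\<langle>\<mu>, \<alpha>\<rangle> \<le> 0" if "\<alpha> \<in> Inv v" for \<alpha>
    using dominant_pos[OF v(2), of "- snd v \<alpha>"] that by (simp add: Inv_iff pair_v pairing_simps)
  have nonneg: "0 \<le> \<langle>\<mu>, \<alpha>\<rangle>" if "\<alpha> \<in> Rp" "\<alpha> \<notin> Inv v" for \<alpha>
  proof -
    have "snd v \<alpha> \<in> Rp"
      using that real_cases[OF W_real[OF v(1), of \<alpha>]] by (auto simp: Inv_iff pos_roots_iff)
    then show ?thesis using dominant_pos[OF v(2)] by (simp add: pair_v)
  qed
  have "aff_length D \<rho> (\<mu>, w) = \<lfloor>2 * weight_pairing \<mu> \<rho>\<rfloor> + (\<Sum>\<alpha>\<in>F. \<bar>\<langle>\<mu>, \<alpha>\<rangle>\<bar> - \<langle>\<mu>, \<alpha>\<rangle>)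
      + (\<Sum>\<alpha>\<in>F. if \<alpha> \<in> ?I then sg \<langle>\<mu>, \<alpha>\<rangle> else 0)"
    if F: "finite F" "F \<subseteq> Rp" "Inv v \<union> ?I \<subseteq> F" for F
  proof -
    have "(\<Sum>\<alpha>\<in>F. \<bar>\<langle>\<mu>, \<alpha>\<rangle>\<bar> - \<langle>\<mu>, \<alpha>\<rangle>) = (\<Sum>\<alpha>\<in>Inv v. \<bar>\<langle>\<mu>, \<alpha>\<rangle>\<bar> - \<langle>\<mu>, \<alpha>\<rangle>)"
      using F nonneg by (intro sum.mono_neutral_right) auto
    also have "\<dots> = (\<Sum>\<alpha>\<in>Inv v. - 2 * \<langle>\<mu>, \<alpha>\<rangle>)"
      using neg by (intro sum.cong) (auto simp: abs_of_nonpos)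
    also have "\<dots> = - 2 * (\<Sum>\<alpha>\<in>Inv v. \<langle>\<mu>, \<alpha>\<rangle>)" by (simp add: sum_distrib_left)
    finally have 1: "(\<Sum>\<alpha>\<in>F. \<bar>\<langle>\<mu>, \<alpha>\<rangle>\<bar> - \<langle>\<mu>, \<alpha>\<rangle>) = - 2 * (\<Sum>\<alpha>\<in>Inv v. \<langle>\<mu>, \<alpha>\<rangle>)" .
    have "(\<Sum>\<alpha>\<in>F. if \<alpha> \<in> ?I then sg \<langle>\<mu>, \<alpha>\<rangle> else 0) = (\<Sum>\<alpha>\<in>?I. if \<alpha> \<in> ?I then sg \<langle>\<mu>, \<alpha>\<rangle> else 0)"
      using F by (intro sum.mono_neutral_right) auto
    also have "\<dots> = (\<Sum>\<alpha>\<in>?I. (if 0 \<le> \<langle>\<mu>, \<alpha>\<rangle> then 1 else 0) - (if \<langle>\<mu>, \<alpha>\<rangle> < 0 then 1 else 0))"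
      by (intro sum.cong) (auto simp: sg_def)
    also have "\<dots> = int (card {\<alpha> \<in> ?I. 0 \<le> \<langle>\<mu>, \<alpha>\<rangle>}) - int (card {\<alpha> \<in> ?I. \<langle>\<mu>, \<alpha>\<rangle> < 0})"
      using fin(2) by (simp add: sum_subtractf flip: sum.inter_filter)
    finally show ?thesis using 1 ht by (simp add: aff_length_def Let_def)
  qed
  moreover have "finite (Inv v \<union> ?I)" using fin by blast
  moreover have "Inv v \<union> ?I \<subseteq> Rp" by (auto simp: weyl_inversions_def)
  ultimately show thesis using that[of "Inv v \<union> ?I"] by blast
qed

text \<open>Outside \<open>Inv \<tau>\<close>, the involution \<open>\<tau>\<close> permutes
  \<open>F\<close> and reverses the pairing with \<open>c\<close>, so these terms cancel. The sum
  over \<open>Inv \<tau>\<close> is the drop of height from \<open>c\<close> to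
  \<open>- c\<close>.\<close>

lemma sum_coweight:
  assumes \<tau>: "\<tau> \<in> W" "fst \<tau> c = - c" "\<And>\<gamma>. snd \<tau> (snd \<tau> \<gamma>) = \<gamma>"
    and F: "finite F" "F \<subseteq> Rp" "Inv \<tau> \<subseteq> F" "\<And>\<alpha>. \<alpha> \<in> F \<Longrightarrow> snd \<tau> \<alpha> \<in> Rp \<Longrightarrow> snd \<tau> \<alpha> \<in> F"
  shows "of_int (\<Sum>\<alpha>\<in>F. \<langle>c, \<alpha>\<rangle>) = 2 * weight_pairing c \<rho>"
proof -
  let ?G = "F - Inv \<tau>"
  have maps: "snd \<tau> \<alpha> \<in> ?G" if "\<alpha> \<in> ?G" for \<alpha>
  proof -
    have "\<alpha> \<in> Rp" using that F(2) by blast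
    then have "snd \<tau> \<alpha> \<in> Rp"
      using that real_cases[OF W_real[OF \<tau>(1), of \<alpha>]] by (auto simp: Inv_iff pos_roots_iff)
    then show ?thesis using that F(4) \<open>\<alpha> \<in> Rp\<close> pos_not_neg by (auto simp: Inv_iff \<tau>(3))
  qed
  have neg: "\<langle>c, snd \<tau> \<alpha>\<rangle> = - \<langle>c, \<alpha>\<rangle>" for \<alpha>
    using W_pairing[OF \<tau>(1), of c "snd \<tau> \<alpha>"] by (simp add: \<tau>(2,3) pairing_simps)
  have "(\<Sum>\<alpha>\<in>?G. \<langle>c, \<alpha>\<rangle>) = (\<Sum>\<alpha>\<in>?G. \<langle>c, snd \<tau> \<alpha>\<rangle>)"
    by (rule sum.reindex_bij_witness[of _ "snd \<tau>" "snd \<tau>"]) (use maps \<tau>(3) in auto)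
  then have "(\<Sum>\<alpha>\<in>?G. \<langle>c, \<alpha>\<rangle>) = 0" by (simp add: neg sum_negf)
  then have "(\<Sum>\<alpha>\<in>F. \<langle>c, \<alpha>\<rangle>) = (\<Sum>\<alpha>\<in>Inv \<tau>. \<langle>c, \<alpha>\<rangle>)"
    using sum.subset_diff[OF F(3,1), of "\<lambda>\<alpha>. \<langle>c, \<alpha>\<rangle>"] by simp
  moreover have "weight_pairing (- c) \<rho> = - weight_pairing c \<rho>"
    by (simp add: weight_pairing_def sum_negf)
  ultimately show ?thesis using height_act[OF \<tau>(1), of c] by (simp add: \<tau>(2))
qed

text \<open>On a finite union of orbits of roots, the length differs from the number of inversions only by a
  linear term in the coweight, and \<open>sum_coweight\<close> makes this term cancel in a difference of lengths.\<close>

lemma length_diff: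
  assumes \<beta>: "\<beta> \<in> Rp" and x: "x \<in> W_tits D" and y: "aff_mult x (aff_reflection D \<beta> n) \<in> W_tits D"
  obtains B where "finite B" "B \<subseteq> R"
    "\<forall>E. finite E \<and> B \<subseteq> E \<and> E \<subseteq> R \<and> (\<forall>\<gamma>\<in>E. - \<gamma> \<in> E \<and> snd (reflection D \<beta>) \<gamma> \<in> E) \<longrightarrow>
      aff_length D \<rho> (aff_mult x (aff_reflection D \<beta> n)) - aff_length D \<rho> x
        = int (card (flips (aff_mult x (aff_reflection D \<beta> n)) E)) - int (card (flips x E))"
proof -
  obtain \<mu> w where x_eq: "x = (\<mu>, w)" by (cases x)
  have w: "w \<in> W" using x by (simp add: x_eq W_tits_def)
  define r where "r = reflection D \<beta>"
  define c where "c = fst w (coroot D \<beta>)"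
  \<comment> \<open>This is the reflection in the image of \<open>\<beta>\<close> under
    \<open>w\<close>, with coroot \<open>c\<close>.\<close>
  define \<tau> where "\<tau> = w \<cdot> r \<cdot> weyl_inverse w"
  have r: "r \<in> W" "snd r (snd r \<gamma>) = \<gamma>" "fst r (coroot D \<beta>) = - coroot D \<beta>" for \<gamma>
    using r_W[OF \<beta>] r_involution[OF \<beta>] r_coroot[OF \<beta>] by (simp_all add: r_def)
  define y where "y = aff_mult x (aff_reflection D \<beta> n)"
  have y_eq: "y = (\<mu> + n *s c, w \<cdot> r)"
    by (simp add: y_def x_eq aff_mult_def aff_reflection_def r_def c_def W_fst_smult w)
  obtain B1 where B1: "finite B1" "B1 \<subseteq> Rp"
    "\<forall>F. finite F \<and> F \<subseteq> Rp \<and> B1 \<subseteq> F \<longrightarrow>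
      aff_length D \<rho> (\<mu>, w) = \<lfloor>2 * weight_pairing \<mu> \<rho>\<rfloor> + (\<Sum>\<alpha>\<in>F. \<bar>\<langle>\<mu>, \<alpha>\<rangle>\<bar> - \<langle>\<mu>, \<alpha>\<rangle>)
        + (\<Sum>\<alpha>\<in>F. if \<alpha> \<in> Inv (weyl_inverse w) then sg \<langle>\<mu>, \<alpha>\<rangle> else 0)"
    using length_formula[OF x[unfolded x_eq]] .
  let ?\<nu> = "\<mu> + n *s c"
  obtain B2 where B2: "finite B2" "B2 \<subseteq> Rp"
    "\<forall>F. finite F \<and> F \<subseteq> Rp \<and> B2 \<subseteq> F \<longrightarrow>
      aff_length D \<rho> (?\<nu>, w \<cdot> r) = \<lfloor>2 * weight_pairing ?\<nu> \<rho>\<rfloor> + (\<Sum>\<alpha>\<in>F. \<bar>\<langle>?\<nu>, \<alpha>\<rangle>\<bar> - \<langle>?\<nu>, \<alpha>\<rangle>)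
        + (\<Sum>\<alpha>\<in>F. if \<alpha> \<in> Inv (weyl_inverse (w \<cdot> r)) then sg \<langle>?\<nu>, \<alpha>\<rangle> else 0)"
    using length_formula[OF y[folded y_def, unfolded y_eq]] .
  have \<tau>: "\<tau> \<in> W" "fst \<tau> c = - c" "snd \<tau> (snd \<tau> \<gamma>) = \<gamma>" for \<gamma>
    using w r W_fst_diff[OF w, of 0 "coroot D \<beta>"] W_fst_diff[OF w, of 0 0]
    by (simp_all add: \<tau>_def c_def W_mult W_inverse)
  let ?T = "B1 \<union> B2 \<union> Inv \<tau>"
  \<comment> \<open>The lengths are summed over positive roots in the image of \<open>E\<close>
    under \<open>w\<close>, so the required roots are pulled back.\<close>
  define B where "B = snd (weyl_inverse w) ` ?T"
  have T: "finite ?T" "?T \<subseteq> Rp" using B1(1,2) B2(1,2) finite_Inv[OF \<tau>(1)] by (auto simp: Inv_iff)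
  show thesis
  proof (rule that[of B])
    show "finite B" using T(1) unfolding B_def by blast
    show "B \<subseteq> R" using T(2) W_real[OF W_inverse(1)[OF w]] unfolding B_def pos_roots_iff[abs_def]
      by (auto simp: pos_roots_iff subset_iff)
  next
    show "\<forall>E. finite E \<and> B \<subseteq> E \<and> E \<subseteq> R \<and> (\<forall>\<gamma>\<in>E. - \<gamma> \<in> E \<and> snd (reflection D \<beta>) \<gamma> \<in> E) \<longrightarrow>
      aff_length D \<rho> (aff_mult x (aff_reflection D \<beta> n)) - aff_length D \<rho> x
        = int (card (flips (aff_mult x (aff_reflection D \<beta> n)) E)) - int (card (flips x E))"
    proof (intro allI impI, elim conjE)
      fix E assume E: "finite E" "B \<subseteq> E" "E \<subseteq> R"
        and "\<forall>\<gamma>\<in>E. - \<gamma> \<in> E \<and> snd (reflection D \<beta>) \<gamma> \<in> E"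
      then have E4: "- \<gamma> \<in> E" and E5: "snd r \<gamma> \<in> E" if "\<gamma> \<in> E" for \<gamma>
        using that by (auto simp: r_def)
      define F where "F = snd w ` E \<inter> Rp"
      \<comment> \<open>Because \<open>E\<close> is stable under \<open>r\<close>, the same
        \<open>F\<close> serves for \<open>x\<close> and \<open>y\<close>.\<close>
      have "snd r ` E = E"
        using E5 r(2) by (auto simp: image_iff) metis
      then have "snd (w \<cdot> r) ` E = snd w ` E" unfolding weyl_mult_def snd_conv image_comp[symmetric] by simp
      then have F': "snd (w \<cdot> r) ` E \<inter> Rp = F" by (simp add: F_def)
      have F: "finite F" "F \<subseteq> Rp" using E(1) by (auto simp: F_def)
      have TF: "?T \<subseteq> F"
      proof
        fix \<alpha> assume "\<alpha> \<in> ?T"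
        then have "snd (weyl_inverse w) \<alpha> \<in> E" "\<alpha> \<in> Rp" using E(2) T(2) by (auto simp: B_def)
        then show "\<alpha> \<in> F" unfolding F_def using W_inverse_apply(4)[OF w, of \<alpha>] by (metis IntI imageI)
      qed
      have closed: "snd \<tau> \<alpha> \<in> F" if "\<alpha> \<in> F" "snd \<tau> \<alpha> \<in> Rp" for \<alpha>
        using that E5 w by (auto simp: F_def \<tau>_def)
      have c: "of_int (\<Sum>\<alpha>\<in>F. \<langle>c, \<alpha>\<rangle>) = 2 * weight_pairing c \<rho>"
        using sum_coweight[OF \<tau> F] TF closed by auto
      have "2 * weight_pairing ?\<nu> \<rho> = 2 * weight_pairing \<mu> \<rho> + of_int (n * (\<Sum>\<alpha>\<in>F. \<langle>c, \<alpha>\<rangle>))"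
        unfolding of_int_mult c by (simp add: weight_pairing_add weight_pairing_smult algebra_simps)
      then have fl: "\<lfloor>2 * weight_pairing ?\<nu> \<rho>\<rfloor> = \<lfloor>2 * weight_pairing \<mu> \<rho>\<rfloor> + n * (\<Sum>\<alpha>\<in>F. \<langle>c, \<alpha>\<rangle>)"
        by (metis floor_add_int)
      have x_len: "aff_length D \<rho> x = \<lfloor>2 * weight_pairing \<mu> \<rho>\<rfloor> - (\<Sum>\<alpha>\<in>F. \<langle>\<mu>, \<alpha>\<rangle>) + int (card (flips x E))"
        using B1(3)[rule_format, of F] F TF card_flips(2)[OF w E(1,3) E4, of \<mu>, folded F_def]
        by (simp add: x_eq sum_subtractf sum.distrib)
      have y_len: "aff_length D \<rho> y = \<lfloor>2 * weight_pairing ?\<nu> \<rho>\<rfloor> - (\<Sum>\<alpha>\<in>F. \<langle>?\<nu>, \<alpha>\<rangle>) + int (card (flips y E))"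
        using B2(3)[rule_format, of F] F TF card_flips(2)[OF W_mult[OF w r(1)] E(1,3) E4, of ?\<nu>, unfolded F']
        by (simp add: y_eq sum_subtractf sum.distrib)
      have "(\<Sum>\<alpha>\<in>F. \<langle>?\<nu>, \<alpha>\<rangle>) = (\<Sum>\<alpha>\<in>F. \<langle>\<mu>, \<alpha>\<rangle>) + n * (\<Sum>\<alpha>\<in>F. \<langle>c, \<alpha>\<rangle>)"
        by (simp add: pairing_simps sum.distrib sum_distrib_left)
      then show "aff_length D \<rho> (aff_mult x (aff_reflection D \<beta> n)) - aff_length D \<rho> x
          = int (card (flips (aff_mult x (aff_reflection D \<beta> n)) E)) - int (card (flips x E))"
        using x_len y_len fl unfolding y_def[symmetric] by simp
    qed
  qed
qed

text \<open>\<open>length_diff\<close> counts the part of the cover set over each large enough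
  finite stable set of roots, always with the same result. Hence enlarging that set never adds an
  element, and the whole cover set lies over one finite set.\<close>

lemma length_step:
  assumes \<beta>: "\<beta> \<in> Rp" and x: "x \<in> W_tits D" and y: "aff_mult x (aff_reflection D \<beta> n) \<in> W_tits D"
    and pos: "aff_pos D (aff_act D x (bracket \<beta> n))"
  shows "finite (cover_set \<beta> n x)"
    and "aff_length D \<rho> (aff_mult x (aff_reflection D \<beta> n)) = aff_length D \<rho> x + int (card (cover_set \<beta> n x))"
proof -
  let ?y = "aff_mult x (aff_reflection D \<beta> n)"
  define r where "r = snd (reflection D \<beta>)"
  have r: "r (r \<gamma>) = \<gamma>" "r (- \<gamma>) = - r \<gamma>" "\<gamma> \<in> R \<Longrightarrow> r \<gamma> \<in> R" for \<gamma>
    using r_involution[OF \<beta>] W_snd_uminus[OF r_W[OF \<beta>]] W_real[OF r_W[OF \<beta>]] by (simp_all add: r_def)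
  have W: "snd x \<in> W" "snd ?y \<in> W" using x y by (auto simp: W_tits_def mem_Times_iff)
  obtain B where B: "finite B" "B \<subseteq> R"
    "\<forall>E. finite E \<and> B \<subseteq> E \<and> E \<subseteq> R \<and> (\<forall>\<gamma>\<in>E. - \<gamma> \<in> E \<and> snd (reflection D \<beta>) \<gamma> \<in> E) \<longrightarrow>
      aff_length D \<rho> ?y - aff_length D \<rho> x = int (card (flips ?y E)) - int (card (flips x E))"
    using length_diff[OF \<beta> x y] .
  \<comment> \<open>Negation and \<open>r\<close> are commuting involutions, so four translates make
    a set stable under both.\<close>
  define cl where "cl A = A \<union> uminus ` A \<union> r ` A \<union> uminus ` r ` A" for A
  have cl: "finite (cover_set \<beta> n x \<inter> cl A \<times> UNIV)"
    "int (card (cover_set \<beta> n x \<inter> cl A \<times> UNIV)) = aff_length D \<rho> ?y - aff_length D \<rho> x"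
    if A: "finite A" "B \<subseteq> A" "A \<subseteq> R" for A
  proof -
    have E: "finite (cl A)" "B \<subseteq> cl A" "cl A \<subseteq> R" using A r(3) by (auto simp: cl_def)
    have neg: "- \<gamma> \<in> cl A" if "\<gamma> \<in> cl A" for \<gamma> using that by (auto simp: cl_def)
    have refl: "snd (reflection D \<beta>) \<gamma> \<in> cl A" if "\<gamma> \<in> cl A" for \<gamma>
      using that unfolding r_def[symmetric] cl_def by (auto simp: r)
    have fin: "finite (flips x (cl A))" "finite (flips ?y (cl A))"
      using card_flips(1)[OF _ E(1,3) neg] W by (metis prod.collapse)+
    show "finite (cover_set \<beta> n x \<inter> cl A \<times> UNIV)"
      "int (card (cover_set \<beta> n x \<inter> cl A \<times> UNIV)) = aff_length D \<rho> ?y - aff_length D \<rho> x"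
      using card_cover_set[OF \<beta> W(1) pos E(3) refl fin] B(3)[rule_format, of "cl A"] E neg refl by auto
  qed
  have sub: "cover_set \<beta> n x \<subseteq> cl B \<times> UNIV"
  proof
    fix a assume a: "a \<in> cover_set \<beta> n x"
    then have A: "finite (insert (fst a) B)" "B \<subseteq> insert (fst a) B" "insert (fst a) B \<subseteq> R"
      using B(1,2) cover_set_iff[OF \<beta> W(1)] by auto
    \<comment> \<open>Two nested finite sets of equal size coincide, so \<open>a\<close> already
      lies over \<open>cl B\<close>.\<close>
    have "cover_set \<beta> n x \<inter> cl B \<times> UNIV \<subseteq> cover_set \<beta> n x \<inter> cl (insert (fst a) B) \<times> UNIV"
      by (auto simp: cl_def)
    moreover have "card (cover_set \<beta> n x \<inter> cl B \<times> UNIV) = card (cover_set \<beta> n x \<inter> cl (insert (fst a) B) \<times> UNIV)"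
      using cl(2)[OF A] cl(2)[OF B(1) order_refl B(2)] by simp
    ultimately have "cover_set \<beta> n x \<inter> cl B \<times> UNIV = cover_set \<beta> n x \<inter> cl (insert (fst a) B) \<times> UNIV"
      using card_subset_eq cl(1)[OF A] by blast
    moreover have "a \<in> cover_set \<beta> n x \<inter> cl (insert (fst a) B) \<times> UNIV"
      using a by (auto simp: cl_def mem_Times_iff)
    ultimately show "a \<in> cl B \<times> UNIV" by blast
  qed
  show "finite (cover_set \<beta> n x)"
    "aff_length D \<rho> ?y = aff_length D \<rho> x + int (card (cover_set \<beta> n x))"
    using cl[OF B(1) order_refl B(2)] sub by (simp_all add: Int_absorb2)
qed

section \<open>Monotonicity of the length in the Bruhat order\<close>

lemma bruhat_step_length:
  assumes "bruhat_step D x y" shows "aff_length D \<rho> x < aff_length D \<rho> y"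
proof -
  obtain \<beta> n where \<beta>: "\<beta> \<in> Rp" "x \<in> W_tits D" "y \<in> W_tits D" "y = aff_mult x (aff_reflection D \<beta> n)"
    "aff_pos D (aff_act D x (bracket \<beta> n))"
    using assms by (auto simp: bruhat_step_def)
  note st = length_step[OF \<beta>(1,2) \<beta>(3)[unfolded \<beta>(4)] \<beta>(5)]
  have "snd x \<in> W" using \<beta>(2) by (auto simp: W_tits_def)
  then have "bracket \<beta> n \<in> cover_set \<beta> n x"
    by (rule bracket_in_cover_set[OF \<beta>(1) _ \<beta>(5)])
  then have "0 < card (cover_set \<beta> n x)" using st(1) card_gt_0_iff by blast
  then show ?thesis using st(2) \<beta>(4) by simp
qed

lemma bruhat_less_length:
  assumes "bruhat_less D x y"
  shows "x \<in> W_tits D" "y \<in> W_tits D" "aff_length D \<rho> x < aff_length D \<rho> y"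
proof -
  show "x \<in> W_tits D" using assms by (simp add: bruhat_less_def bruhat_le_def)
  \<comment> \<open>Distinctness excludes the empty chain.\<close>
  have "(bruhat_step D)\<^sup>+\<^sup>+ x y"
    using assms by (auto simp: bruhat_less_def bruhat_le_def dest: rtranclpD)
  then have "y \<in> W_tits D \<and> aff_length D \<rho> x < aff_length D \<rho> y"
  proof induction
    case (base y)
    then show ?case using bruhat_step_length by (simp add: bruhat_step_def)
  next
    case (step y z)
    then show ?case using bruhat_step_length[OF step.hyps(2)] by (simp add: bruhat_step_def)
  qed
  then show "y \<in> W_tits D" "aff_length D \<rho> x < aff_length D \<rho> y" by simp_all
qed

end

theorem theorem3p7:
  fixes D :: "('n::finite, 'i::finite) root_datum"
    and \<rho> :: "real ^ 'n"
    and \<mu> :: "int ^ 'n"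
    and w :: "('n, 'i) weyl"
    and \<beta> :: "int ^ 'i"
    and n :: int
  assumes "kac_moody_datum D"
    and "is_rho D \<rho>"
    and "(\<mu>, w) \<in> W_tits D"
    and "\<beta> \<in> pos_roots D"
    and "bruhat_less D (\<mu>, w) (aff_mult (\<mu>, w) (aff_reflection D \<beta> n))"
  shows "let x = (\<mu>, w);
             s = aff_reflection D \<beta> n;
             S = {a \<in> aff_inversions D s.
                    aff_pos D (aff_act D x a) \<and> aff_pos D (aff_act D x (- aff_act D s a))}
         in aff_length D \<rho> (aff_mult x s) = aff_length D \<rho> x + int (card S) \<and> finite S"
proof -
  interpret kac_moody_rho D \<rho>
    by unfold_locales (fact assms(1,2))+
  let ?x = "(\<mu>, w)" and ?s = "aff_reflection D \<beta> n"
  let ?y = "aff_mult ?x ?s"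
  note less = bruhat_less_length[OF assms(5)]
  have W: "snd ?x \<in> weyl_group D" using assms(3) by (simp add: W_tits_def)
  have "aff_pos D (aff_act D ?x (bracket \<beta> n))"
  proof (rule ccontr)
    assume "\<not> aff_pos D (aff_act D ?x (bracket \<beta> n))"
    \<comment> \<open>The hypothesis only supplies a chain of steps from \<open>?x\<close> to
      \<open>?y\<close>, so the sign is obtained by contradiction: \<open>s\<close> negates
      \<open>bracket \<beta> n\<close>, hence \<open>?y\<close> makes it positive, and
      \<open>?x\<close>, being \<open>?y\<close> times \<open>s\<close>, would be one step above
      \<open>?y\<close>.\<close>
    then have "aff_pos D (aff_act D ?y (bracket \<beta> n))"
      using bracket_root[OF assms(4), of n] W
      by (simp add: aff_act_mult[OF W] s_bracket[OF assms(4)] aff_act_uminus aff_pos_uminus W_real)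
    then have "bruhat_step D ?y ?x"
      unfolding bruhat_step_def using less(1,2) assms(4) mult_s_s[OF assms(4) W, of n] by metis
    then show False using bruhat_step_length less(3) by fastforce
  qed
  then show ?thesis
    using length_step[OF assms(4) less(1,2)] by (simp add: cover_set_def[OF assms(4)] Let_def)
qed

end
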